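(* Let $f\in L^2(I)$ and let $n\ge 0$ be an integer. (1) Problem PBEP(n) has a unique solution: there is exactly one $k_n\in P_n$ with $|k_n|\le 1$ a.e. on $J$ such that $$\|f-k_n\|_{L^2(I)}=\inf\{\|f-g\|_{L^2(I)}:\ g\in P_n,\ |g|\le 1\text{ a.e. on }J\}.$$ (2) Problem ABEP has a unique solution: there is exactly one $g_0\in H^2$ with $|g_0|\le 1$ a.e. on $J$ such that $$\|f-g_0\|_{L^2(I)}=\inf\{\|f-g\|_{L^2(I)}:\ g\in H^2,\ |g|\le 1\text{ a.e. on }J\}.$$ (3) Moreover, the solution $g_0$ to ABEP satisfies $|g_0|=1$ almost everywhere on $J$, unless $f=g_{|_I}$ for some $g\in H^2$ such that $\|g\|_{L^\infty(J)}\le 1$.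
   Context: $\mathbb{T}$ is the unit circle, $I\subset\mathbb{T}$ is a finite union of nonempty open arcs whose complement $J=\mathbb{T}\setminus I$ has nonempty interior (in $\mathbb{T}$). All functions are complex-valued. For measurable $E\subset\mathbb{T}$ and $1\le p<\infty$, $\|f\|_{L^p(E)}=\left(\frac1{2\pi}\int_E|f(e^{i\theta})|^p\,d\theta\right)^{1/p}$, and $\|f\|_{L^\infty(E)}$ is the essential supremum of $|f|$ on $E$. $H^2$ is the Hardy space of the disk, viewed as the closed subspace of $L^2(\mathbb{T})$ of functions whose Fourier coefficients of strictly negative index vanish. $P_n$ is the space of complex algebraic polynomials of degree at most $n$. $h_{|_E}$ denotes restriction to $E$. *)

theory Defs
  imports "HOL-Probability.Probability" "HOL-Computational_Algebra.Polynomial"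
begin

abbreviation unit_circle :: "complex set" where
  "unit_circle \<equiv> sphere 0 1"

text \<open>An open arc is the image under \<open>\<theta> \<mapsto> exp (\<i>\<theta>)\<close> of an open interval of
  length at most \<open>2\<pi>\<close>; it is nonempty.\<close>

definition open_arc :: "complex set \<Rightarrow> bool" where
  "open_arc A \<longleftrightarrow> (\<exists>a b. a < b \<and> b \<le> a + 2 * pi \<and> A = cis ` {a<..<b})"

text \<open>Normalised arc length \<open>d\<theta>/(2\<pi>)\<close> on the Borel sets of the circle. Elements of the
  Lebesgue spaces are represented by Borel functions (every class modulo null sets contains one),
  and equality in these spaces is equality almost everywhere. The values of a function
  off the circle play no role.\<close>

definition circle_measure :: "complex measure" where
  "circle_measure =
     distr (uniform_measure lborel {0..<2 * pi}) (restrict_space borel unit_circle) cis"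

lemma cis_measurable_circle [measurable]:
  "cis \<in> uniform_measure lborel {0..<2 * pi} \<rightarrow>\<^sub>M restrict_space borel unit_circle"
proof -
  have "cis \<in> borel_measurable borel"
    by (intro borel_measurable_continuous_onI continuous_intros)
  then have "cis \<in> borel \<rightarrow>\<^sub>M restrict_space borel unit_circle"
    by (intro measurable_restrict_space2) auto
  then show ?thesis by simp
qed

lemma space_circle_measure [simp]: "space circle_measure = unit_circle"
  by (simp add: circle_measure_def space_restrict_space)

lemma sets_circle_measure [measurable_cong]:
  "sets circle_measure = sets (restrict_space borel unit_circle)"
  by (simp add: circle_measure_def)

lemma prob_space_circle_measure: "prob_space circle_measure"
  unfolding circle_measure_def
  by (intro prob_space.prob_space_distr prob_space_uniform_measure) simp_all

lemma integral_circle_measure: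
  fixes f :: "complex \<Rightarrow> 'a::{banach, second_countable_topology}"
  assumes "f \<in> borel_measurable circle_measure"
  shows "(LINT z|circle_measure. f z) = (LBINT \<theta>:{0..<2 * pi}. f (cis \<theta>)) /\<^sub>R (2 * pi)"
proof -
  have f: "f \<in> borel_measurable (restrict_space borel unit_circle)"
    using assms by (simp add: circle_measure_def)
  have c: "cis \<in> lborel \<rightarrow>\<^sub>M restrict_space borel unit_circle"
    using cis_measurable_circle by simp
  have fc: "(\<lambda>\<theta>. f (cis \<theta>)) \<in> borel_measurable lborel"
    by (rule measurable_compose[OF c f])
  have e: "1 / ennreal (2 * pi) = ennreal (1 / (2 * pi))"
    using divide_ennreal[of 1 "2 * pi"] by simp
  have d: "uniform_measure lborel {0..<2 * pi} =
      density lborel (\<lambda>\<theta>. ennreal (indicator {0..<2 * pi} \<theta> / (2 * pi)))"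
  proof -
    have "indicator {0..<2 * pi} \<theta> / emeasure lborel {0..<2 * pi} =
        ennreal (indicator {0..<2 * pi} \<theta> / (2 * pi))" for \<theta> :: real
      by (cases "\<theta> \<in> {0..<2 * pi}") (simp_all add: e)
    then show ?thesis
      unfolding uniform_measure_def by simp
  qed
  have "(LINT z|circle_measure. f z) = (LINT \<theta>|uniform_measure lborel {0..<2 * pi}. f (cis \<theta>))"
    unfolding circle_measure_def by (rule integral_distr[OF cis_measurable_circle f])
  also have "\<dots> = (LINT \<theta>|lborel. (indicator {0..<2 * pi} \<theta> / (2 * pi)) *\<^sub>R f (cis \<theta>))"
    unfolding d by (rule integral_density) (use fc in auto)
  also have "\<dots> = (LBINT \<theta>:{0..<2 * pi}. f (cis \<theta>)) /\<^sub>R (2 * pi)"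
  proof -
    have "(indicator {0..<2 * pi} \<theta> / (2 * pi)) *\<^sub>R f (cis \<theta>) =
        inverse (2 * pi) *\<^sub>R (indicator {0..<2 * pi} \<theta> *\<^sub>R f (cis \<theta>))" for \<theta>
      by (simp only: scaleR_scaleR divide_inverse mult.commute)
    then show ?thesis
      unfolding set_lebesgue_integral_def by (simp only: integral_scaleR_right)
  qed
  finally show ?thesis .
qed

definition L2_on :: "complex set \<Rightarrow> (complex \<Rightarrow> complex) set" where
  "L2_on E = {f. set_borel_measurable circle_measure E f \<and>
                 set_integrable circle_measure E (\<lambda>z. (cmod (f z))\<^sup>2)}"

definition L2_norm_on :: "complex set \<Rightarrow> (complex \<Rightarrow> complex) \<Rightarrow> real" where
  "L2_norm_on E f = sqrt (LINT z:E|circle_measure. (cmod (f z))\<^sup>2)"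

definition Linf_norm_on :: "complex set \<Rightarrow> (complex \<Rightarrow> complex) \<Rightarrow> ereal" where
  "Linf_norm_on E f = esssup (restrict_space circle_measure E) (\<lambda>z. ereal (cmod (f z)))"

definition fourier_coeff :: "(complex \<Rightarrow> complex) \<Rightarrow> int \<Rightarrow> complex" where
  "fourier_coeff g k = (LINT z|circle_measure. g z * z powi (- k))"

definition Hardy2 :: "(complex \<Rightarrow> complex) set" where
  "Hardy2 = {g \<in> L2_on unit_circle. \<forall>k<0. fourier_coeff g k = 0}"

definition bounded_by_1_on :: "complex set \<Rightarrow> (complex \<Rightarrow> complex) \<Rightarrow> bool" where
  "bounded_by_1_on J g \<longleftrightarrow> (AE z in circle_measure. z \<in> J \<longrightarrow> cmod (g z) \<le> 1)"

definition PBEP_solution ::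
    "complex set \<Rightarrow> complex set \<Rightarrow> (complex \<Rightarrow> complex) \<Rightarrow> nat \<Rightarrow> complex poly \<Rightarrow> bool" where
  "PBEP_solution I J f n k \<longleftrightarrow>
     degree k \<le> n \<and> bounded_by_1_on J (poly k) \<and>
     L2_norm_on I (\<lambda>z. f z - poly k z) =
       (INF g\<in>{g. degree g \<le> n \<and> bounded_by_1_on J (poly g)}.
          L2_norm_on I (\<lambda>z. f z - poly g z))"

definition ABEP_solution ::
    "complex set \<Rightarrow> complex set \<Rightarrow> (complex \<Rightarrow> complex) \<Rightarrow> (complex \<Rightarrow> complex) \<Rightarrow> bool" where
  "ABEP_solution I J f g0 \<longleftrightarrow>
     g0 \<in> Hardy2 \<and> bounded_by_1_on J g0 \<and>
     L2_norm_on I (\<lambda>z. f z - g0 z) =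
       (INF g\<in>{g \<in> Hardy2. bounded_by_1_on J g}. L2_norm_on I (\<lambda>z. f z - g z))"

end

theory Submission
  imports Defs
begin

text \<open>Existence in both problems is a two-stage minimisation: first the distance to \<open>f\<close> on \<open>I\<close>, then
  the norm on \<open>J\<close> among near-minimisers, which yields a sequence that is Cauchy on the whole circle.

  The rest depends on one construction. If \<open>K\<close> has positive measure, minimise
  \<open>\<integral> w |p|\<^sup>2\<close> over polynomials with \<open>p(0) = 1\<close>, where \<open>w\<close> is small on \<open>K\<close> and \<open>1\<close> elsewhere. The extremal \<open>V\<close>
  makes \<open>w |V|\<^sup>2\<close> orthogonal to all \<open>z\<^sup>k\<close>, \<open>k \<noteq> 0\<close>, hence constant, and this constant tends to \<open>0\<close> with the
  weight. So \<open>V\<close> is bounded, tiny off \<open>K\<close>, and \<open>(1 - V) / z\<close> is a bounded analytic function uniformly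
  close to \<open>1 / z\<close> off \<open>K\<close>. Therefore bounded analytic functions approximate all trigonometric polynomials
  uniformly off \<open>K\<close>. This shows that an \<open>H\<^sup>2\<close> function vanishing on \<open>K\<close> is zero, which gives uniqueness.
  For the last claim, if \<open>|g0|\<close> is bounded away from \<open>1\<close> on \<open>K \<subseteq> J\<close>, then \<open>g0\<close> may be perturbed
  towards any \<open>v\<close> that is bounded by \<open>1\<close> on \<open>J - K\<close> and merely bounded on \<open>K\<close>; such \<open>v\<close> approximate every continuous function vanishing
  on \<open>J\<close>, and the first-order condition forces \<open>f = g0\<close> on \<open>I\<close>.\<close>

section \<open>Square integrable functions\<close>

text \<open>The usual route uses outer functions, that is, logarithmic integrals and boundary
  values. Here everything stays on the circle: \<open>V\<close> is the outer function with value 1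
  at the origin whose modulus squared is proportional to \<open>1 / w\<close>, and it is obtained by
  least squares. The orthogonality of \<open>w |V|^2\<close> to the powers comes from comparing
  \<open>V\<close> with \<open>(1 + t * z ^ k) * V\<close>, which has the same value at 0. Instead
  of evaluating the constant, the multiplier is halved on \<open>K\<close> repeatedly: the old
  extremal, used as a test function, shows that each halving shrinks the constant by a fixed factor
  below 1. The difficulty in the last claim is that a competitor must respect the bound on all of
  \<open>J\<close>, while only its values on \<open>I\<close> affect the distance. Slack on a small
  \<open>K\<close> inside \<open>J\<close> is enough: a large \<open>v\<close> on \<open>K\<close>
  is harmless for the pairing, because the residual vanishes there, and harmless for the constraint,
  because the step towards \<open>v\<close> may be short.\<close>

definition square_integrable :: "'a measure \<Rightarrow> ('a \<Rightarrow> complex) \<Rightarrow> bool" where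
  "square_integrable M g \<longleftrightarrow> g \<in> borel_measurable M \<and> integrable M (\<lambda>x. (cmod (g x))\<^sup>2)"

text \<open>Membership of all terms and of the limit is built in: the integral of a non-integrable
  function is 0 by convention, so the numerical limit alone would carry no information.\<close>

definition L2_tendsto :: "'a measure \<Rightarrow> (nat \<Rightarrow> 'a \<Rightarrow> complex) \<Rightarrow> ('a \<Rightarrow> complex) \<Rightarrow> bool" where
  "L2_tendsto M s g \<longleftrightarrow> (\<forall>n. square_integrable M (s n)) \<and> square_integrable M g \<and>
     (\<lambda>n. LINT x|M. (cmod (s n x - g x))\<^sup>2) \<longlonglongrightarrow> 0"

lemma square_integrable_measurable: "square_integrable M g \<Longrightarrow> g \<in> borel_measurable M"
  by (simp add: square_integrable_def)

lemma square_integrable_norm_sq: "square_integrable M g \<Longrightarrow> integrable M (\<lambda>x. (cmod (g x))\<^sup>2)"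
  by (simp add: square_integrable_def)

lemma square_integrable_bound:
  assumes "g \<in> borel_measurable M" "integrable M h" "AE x in M. (cmod (g x))\<^sup>2 \<le> h x"
  shows "square_integrable M g"
  unfolding square_integrable_def
proof
  show "integrable M (\<lambda>x. (cmod (g x))\<^sup>2)"
    by (rule Bochner_Integration.integrable_bound[OF assms(2)]) (use assms in auto)
qed (use assms in simp)

lemma norm_add_sq_le: "(cmod (a + b))\<^sup>2 \<le> 2 * (cmod a)\<^sup>2 + 2 * (cmod b)\<^sup>2"
proof -
  have "(cmod (a + b))\<^sup>2 \<le> (cmod a + cmod b)\<^sup>2"
    by (intro power_mono norm_triangle_ineq) simp
  also have "\<dots> \<le> 2 * (cmod a)\<^sup>2 + 2 * (cmod b)\<^sup>2"
    using zero_le_power2[of "cmod a - cmod b"] by (simp add: power2_sum power2_diff)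
  finally show ?thesis .
qed

lemma square_integrable_add:
  assumes "square_integrable M a" "square_integrable M b"
  shows "square_integrable M (\<lambda>x. a x + b x)"
proof (rule square_integrable_bound)
  show "integrable M (\<lambda>x. 2 * (cmod (a x))\<^sup>2 + 2 * (cmod (b x))\<^sup>2)"
    using assms by (auto simp: square_integrable_def)
qed (use assms in \<open>auto simp: square_integrable_def norm_add_sq_le\<close>)

lemma square_integrable_bounded_mult:
  assumes "square_integrable M a" "w \<in> borel_measurable M" "AE x in M. cmod (w x) \<le> B"
  shows "square_integrable M (\<lambda>x. w x * a x)"
proof (rule square_integrable_bound)
  show "integrable M (\<lambda>x. B\<^sup>2 * (cmod (a x))\<^sup>2)"
    using assms by (auto simp: square_integrable_def)
  show "AE x in M. (cmod (w x * a x))\<^sup>2 \<le> B\<^sup>2 * (cmod (a x))\<^sup>2"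
    using assms(3)
    by eventually_elim (simp add: norm_mult power_mult_distrib mult_right_mono power_mono)
qed (use assms in \<open>auto simp: square_integrable_def\<close>)

lemma square_integrable_cmult:
  "square_integrable M a \<Longrightarrow> square_integrable M (\<lambda>x. c * a x)"
  by (rule square_integrable_bounded_mult[where B = "cmod c"]) auto

lemma square_integrable_diff:
  assumes "square_integrable M a" "square_integrable M b"
  shows "square_integrable M (\<lambda>x. a x - b x)"
  using square_integrable_add[OF assms(1) square_integrable_cmult[OF assms(2), of "-1"]] by simp

lemma square_integrable_cnj:
  "square_integrable M a \<Longrightarrow> square_integrable M (\<lambda>x. cnj (a x))"
  by (auto simp: square_integrable_def intro: borel_measurable_continuous_on[of cnj] continuous_intros)

lemma (in finite_measure) square_integrable_AE_bounded:
  assumes "g \<in> borel_measurable M" "AE x in M. cmod (g x) \<le> B"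
  shows "square_integrable M g"
  by (rule square_integrable_bound[where h = "\<lambda>_. B\<^sup>2"])
    (use assms in \<open>auto elim!: eventually_mono intro!: power_mono\<close>)

lemma norm_mult_le_sq: "cmod (a * b) \<le> (cmod a)\<^sup>2 + (cmod b)\<^sup>2"
proof -
  have "2 * (cmod a * cmod b) \<le> (cmod a)\<^sup>2 + (cmod b)\<^sup>2"
    using zero_le_power2[of "cmod a - cmod b"] by (simp add: power2_diff)
  moreover have "0 \<le> cmod a * cmod b" by simp
  ultimately show ?thesis unfolding norm_mult by linarith
qed

lemma integrable_mult_square_integrable:
  assumes "square_integrable M a" "square_integrable M b"
  shows "integrable M (\<lambda>x. a x * b x)"
proof (rule Bochner_Integration.integrable_bound)
  show "integrable M (\<lambda>x. (cmod (a x))\<^sup>2 + (cmod (b x))\<^sup>2)"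
    using assms by (auto simp: square_integrable_def)
  show "AE x in M. norm (a x * b x) \<le> norm ((cmod (a x))\<^sup>2 + (cmod (b x))\<^sup>2)"
    using norm_mult_le_sq by (auto intro: order_trans)
qed (use assms in \<open>auto simp: square_integrable_def\<close>)

lemma (in finite_measure) integrable_square_integrable:
  assumes "square_integrable M a"
  shows "integrable M a"
  using integrable_mult_square_integrable[OF assms square_integrable_AE_bounded[of "\<lambda>_. 1" 1]] by simp

lemma Cauchy_Schwarz_square_integrable:
  assumes a: "square_integrable M a" and b: "square_integrable M b"
  shows "LINT x|M. cmod (a x) * cmod (b x) \<le>
    sqrt (LINT x|M. (cmod (a x))\<^sup>2) * sqrt (LINT x|M. (cmod (b x))\<^sup>2)"
proof -
  note [measurable] = square_integrable_measurable[OF a] square_integrable_measurable[OF b]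
  have i: "integrable M (\<lambda>x. cmod (a x) * cmod (b x))"
    using integrable_mult_square_integrable[OF a b, THEN integrable_norm] by (simp add: norm_mult)
  have "(\<integral>\<^sup>+x. ennreal (cmod (a x)) * ennreal (cmod (b x)) \<partial>M)\<^sup>2 \<le>
      (\<integral>\<^sup>+x. ennreal (cmod (a x)) ^ 2 \<partial>M) * (\<integral>\<^sup>+x. ennreal (cmod (b x)) ^ 2 \<partial>M)"
    by (rule Cauchy_Schwarz_nn_integral) auto
  also have "(\<integral>\<^sup>+x. ennreal (cmod (a x)) * ennreal (cmod (b x)) \<partial>M) =
      ennreal (LINT x|M. cmod (a x) * cmod (b x))"
    by (subst nn_integral_eq_integral[OF i, symmetric]) (auto simp: ennreal_mult)
  also have "(\<integral>\<^sup>+x. ennreal (cmod (a x)) ^ 2 \<partial>M) = ennreal (LINT x|M. (cmod (a x))\<^sup>2)"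
    by (subst nn_integral_eq_integral[OF square_integrable_norm_sq[OF a], symmetric])
      (auto simp: ennreal_power)
  also have "(\<integral>\<^sup>+x. ennreal (cmod (b x)) ^ 2 \<partial>M) = ennreal (LINT x|M. (cmod (b x))\<^sup>2)"
    by (subst nn_integral_eq_integral[OF square_integrable_norm_sq[OF b], symmetric])
      (auto simp: ennreal_power)
  finally have "(LINT x|M. cmod (a x) * cmod (b x))\<^sup>2 \<le>
      (LINT x|M. (cmod (a x))\<^sup>2) * (LINT x|M. (cmod (b x))\<^sup>2)"
    by (simp add: ennreal_power ennreal_mult[symmetric])
  then show ?thesis
    by (metis real_le_rsqrt real_sqrt_mult)
qed

lemma norm_integral_mult_le:
  assumes a: "square_integrable M a" and b: "square_integrable M b"
  shows "cmod (LINT x|M. a x * b x) \<le>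
    sqrt (LINT x|M. (cmod (a x))\<^sup>2) * sqrt (LINT x|M. (cmod (b x))\<^sup>2)"
proof -
  have "cmod (LINT x|M. a x * b x) \<le> (LINT x|M. cmod (a x * b x))"
    by (rule integral_norm_bound)
  then show ?thesis
    using Cauchy_Schwarz_square_integrable[OF a b] by (simp add: norm_mult)
qed

section \<open>Convergence in the mean\<close>

lemma L2_tendsto_const: "square_integrable M g \<Longrightarrow> L2_tendsto M (\<lambda>_. g) g"
  by (simp add: L2_tendsto_def)

lemma L2_tendsto_cnj: "L2_tendsto M s g \<Longrightarrow> L2_tendsto M (\<lambda>n x. cnj (s n x)) (\<lambda>x. cnj (g x))"
  by (simp add: L2_tendsto_def square_integrable_cnj flip: complex_cnj_diff)

lemma L2_tendsto_bounded_mult: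
  assumes s: "L2_tendsto M s g" and w: "w \<in> borel_measurable M" "AE x in M. cmod (w x) \<le> B"
  shows "L2_tendsto M (\<lambda>n x. w x * s n x) (\<lambda>x. w x * g x)"
  unfolding L2_tendsto_def
proof (intro conjI allI)
  show "square_integrable M (\<lambda>x. w x * s n x)" for n
    using s w unfolding L2_tendsto_def by (blast intro: square_integrable_bounded_mult)
  show "square_integrable M (\<lambda>x. w x * g x)"
    using s w unfolding L2_tendsto_def by (blast intro: square_integrable_bounded_mult)
  have d: "square_integrable M (\<lambda>x. s n x - g x)" for n
    using s unfolding L2_tendsto_def by (blast intro: square_integrable_diff)
  show "(\<lambda>n. LINT x|M. (cmod (w x * s n x - w x * g x))\<^sup>2) \<longlonglongrightarrow> 0"
  proof (rule tendsto_sandwich[OF _ _ tendsto_const])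
    show "\<forall>\<^sub>F n in sequentially. (LINT x|M. (cmod (w x * s n x - w x * g x))\<^sup>2) \<le>
        B\<^sup>2 * (LINT x|M. (cmod (s n x - g x))\<^sup>2)"
    proof (rule always_eventually, rule allI)
      fix n
      have "(LINT x|M. (cmod (w x * s n x - w x * g x))\<^sup>2) \<le> (LINT x|M. B\<^sup>2 * (cmod (s n x - g x))\<^sup>2)"
      proof (rule integral_mono_AE)
        show "integrable M (\<lambda>x. (cmod (w x * s n x - w x * g x))\<^sup>2)"
          using square_integrable_bounded_mult[OF d w] by (simp add: square_integrable_def algebra_simps)
        show "integrable M (\<lambda>x. B\<^sup>2 * (cmod (s n x - g x))\<^sup>2)"
          using d by (simp add: square_integrable_def)
        show "AE x in M. (cmod (w x * s n x - w x * g x))\<^sup>2 \<le> B\<^sup>2 * (cmod (s n x - g x))\<^sup>2"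
          using w(2)
          by eventually_elim
            (simp add: norm_mult power_mult_distrib mult_right_mono power_mono flip: right_diff_distrib)
      qed
      then show "(LINT x|M. (cmod (w x * s n x - w x * g x))\<^sup>2) \<le>
        B\<^sup>2 * (LINT x|M. (cmod (s n x - g x))\<^sup>2)" by simp
    qed
    show "(\<lambda>n. B\<^sup>2 * (LINT x|M. (cmod (s n x - g x))\<^sup>2)) \<longlonglongrightarrow> 0"
      using s by (auto simp: L2_tendsto_def intro: tendsto_eq_intros)
  qed auto
qed

lemma L2_tendsto_integral_mult:
  assumes a: "L2_tendsto M s a" and b: "L2_tendsto M t b"
  shows "(\<lambda>n. LINT x|M. s n x * t n x) \<longlonglongrightarrow> (LINT x|M. a x * b x)"
proof -
  let ?N = "\<lambda>g. sqrt (LINT x|M. (cmod (g x))\<^sup>2)"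
  have sq: "square_integrable M (s n)" "square_integrable M (t n)"
    "square_integrable M a" "square_integrable M b" for n
    using a b by (auto simp: L2_tendsto_def)
  note sqd = square_integrable_diff[OF sq(1,3)] square_integrable_diff[OF sq(2,4)]
  have bound: "cmod ((LINT x|M. s n x * t n x) - (LINT x|M. a x * b x)) \<le>
      ?N (\<lambda>x. s n x - a x) * ?N (\<lambda>x. t n x - b x) + ?N a * ?N (\<lambda>x. t n x - b x)
      + ?N (\<lambda>x. s n x - a x) * ?N b" for n
  proof -
    have "(LINT x|M. s n x * t n x) - (LINT x|M. a x * b x) =
        (LINT x|M. s n x * t n x - a x * b x)"
      by (intro Bochner_Integration.integral_diff[symmetric] integrable_mult_square_integrable sq)
    \<comment> \<open>The only factors that do not tend to 0 are the fixed limits \<open>a\<close>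
      and \<open>b\<close>, so Cauchy-Schwarz settles each term without a uniform bound on the two
      sequences.\<close>
    also have "\<dots> = (LINT x|M. ((s n x - a x) * (t n x - b x) + a x * (t n x - b x)) + (s n x - a x) * b x)"
      by (rule Bochner_Integration.integral_cong) (simp_all add: algebra_simps)
    also have "\<dots> = (LINT x|M. (s n x - a x) * (t n x - b x)) + (LINT x|M. a x * (t n x - b x))
        + (LINT x|M. (s n x - a x) * b x)"
      by (simp add: integrable_mult_square_integrable sq sqd)
    finally show ?thesis
      using norm_integral_mult_le[OF sqd, of n n] norm_integral_mult_le[OF sq(3) sqd(2)[of n]]
        norm_integral_mult_le[OF sqd(1)[of n] sq(4)]
      by (smt (verit) norm_triangle_ineq)
  qed
  have z: "(\<lambda>n. ?N (\<lambda>x. s n x - a x)) \<longlonglongrightarrow> 0" "(\<lambda>n. ?N (\<lambda>x. t n x - b x)) \<longlonglongrightarrow> 0"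
    using a b tendsto_real_sqrt by (fastforce simp: L2_tendsto_def)+
  have "(\<lambda>n. ?N (\<lambda>x. s n x - a x) * ?N (\<lambda>x. t n x - b x) + ?N a * ?N (\<lambda>x. t n x - b x)
      + ?N (\<lambda>x. s n x - a x) * ?N b) \<longlonglongrightarrow> 0 * 0 + ?N a * 0 + 0 * ?N b"
    by (intro tendsto_intros z)
  then have "(\<lambda>n. (LINT x|M. s n x * t n x) - (LINT x|M. a x * b x)) \<longlonglongrightarrow> 0"
    by (intro Lim_null_comparison[OF always_eventually[OF allI[OF bound]]]) simp
  then show ?thesis
    by (simp add: LIM_zero_iff)
qed

lemma L2_tendsto_AE_subseq:
  assumes "L2_tendsto M s g"
  obtains r where "strict_mono (r::nat \<Rightarrow> nat)" "AE x in M. (\<lambda>n. s (r n) x) \<longlonglongrightarrow> g x"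
proof -
  have d: "square_integrable M (\<lambda>x. s n x - g x)" for n
    using assms unfolding L2_tendsto_def by (blast intro: square_integrable_diff)
  obtain r where r: "strict_mono (r::nat \<Rightarrow> nat)"
    "AE x in M. (\<lambda>n. (cmod (s (r n) x - g x))\<^sup>2) \<longlonglongrightarrow> 0"
    using tendsto_L1_AE_subseq[of M "\<lambda>n x. (cmod (s n x - g x))\<^sup>2"] assms square_integrable_norm_sq[OF d]
    by (auto simp: L2_tendsto_def)
  have "AE x in M. (\<lambda>n. s (r n) x) \<longlonglongrightarrow> g x"
    using r(2)
  proof eventually_elim
    case (elim x)
    then have "(\<lambda>n. s (r n) x - g x) \<longlonglongrightarrow> 0"
      using tendsto_real_sqrt[OF elim] by (simp add: tendsto_norm_zero_iff)
    then show ?case by (simp add: LIM_zero_iff)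
  qed
  with r(1) show ?thesis by (rule that)
qed

text \<open>Riesz-Fischer. On a finite measure space Cauchy-Schwarz against the constant 1 turns an
  L2 Cauchy sequence into an L1 Cauchy sequence, which has a subsequence converging almost
  everywhere. Fatou's lemma then shows that the pointwise limit is the L2 limit of the whole
  sequence.\<close>

lemma (in finite_measure) L2_complete:
  assumes sq: "\<And>n. square_integrable M (s n)"
    and cauchy: "\<And>e. e > 0 \<Longrightarrow> \<exists>N. \<forall>i\<ge>N. \<forall>j\<ge>N. (LINT x|M. (cmod (s i x - s j x))\<^sup>2) < e"
  obtains g where "L2_tendsto M s g"
proof -
  note [measurable] = square_integrable_measurable[OF sq]
  note sqd = square_integrable_diff[OF sq sq]
  define m where "m = measure M (space M)"
  have L1: "(LINT x|M. cmod (s i x - s j x)) \<le> sqrt (LINT x|M. (cmod (s i x - s j x))\<^sup>2) * sqrt m" for i j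
    using Cauchy_Schwarz_square_integrable[OF sqd square_integrable_AE_bounded[of "\<lambda>_. 1" 1], of i j]
    by (simp add: m_def)
  have "\<exists>N. \<forall>i\<ge>N. \<forall>j\<ge>N. (LINT x|M. norm (s i x - s j x)) < e" if "e > 0" for e
  proof -
    have m: "0 \<le> m" by (simp add: m_def)
    \<comment> \<open>Chosen so that \<open>sqrt e' * sqrt m < e\<close>; the added 1 covers the
      case of total mass 0.\<close>
    define e' where "e' = (e / (sqrt m + 1))\<^sup>2"
    have p: "0 < sqrt m + 1" using m by (simp add: add_nonneg_pos)
    then have "e' > 0" using that by (simp add: e'_def)
    from cauchy[OF this] obtain N where
      N: "(LINT x|M. (cmod (s i x - s j x))\<^sup>2) < e'" if "i \<ge> N" "j \<ge> N" for i j by blast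
    have "(LINT x|M. norm (s i x - s j x)) < e" if ij: "i \<ge> N" "j \<ge> N" for i j
    proof -
      have "sqrt (LINT x|M. (cmod (s i x - s j x))\<^sup>2) \<le> sqrt e'"
        using N[OF ij] by simp
      also have "sqrt e' = e / (sqrt m + 1)"
        using \<open>e > 0\<close> p by (simp add: e'_def)
      finally have "(LINT x|M. norm (s i x - s j x)) \<le> e / (sqrt m + 1) * sqrt m"
        using L1[of i j] m by (meson mult_right_mono order_trans real_sqrt_ge_zero)
      also have "\<dots> < e" using p \<open>e > 0\<close> by (simp add: field_simps)
      finally show ?thesis .
    qed
    then show ?thesis by blast
  qed
  then obtain r where r: "strict_mono r" "AE x in M. Cauchy (\<lambda>i. s (r i) x)"
    by (rule cauchy_L1_AE_cauchy_subseq[OF integrable_square_integrable[OF sq]])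
  define g where "g x = lim (\<lambda>i. s (r i) x)" for x
  have [measurable]: "g \<in> borel_measurable M"
    unfolding g_def by measurable
  have conv: "AE x in M. (\<lambda>i. s (r i) x) \<longlonglongrightarrow> g x"
    using r(2) by eventually_elim (simp add: g_def Cauchy_convergent_iff convergent_LIMSEQ_iff)
  \<comment> \<open>Stated for the nonnegative integral because the integrability of the left side
    is one of its consequences.\<close>
  have fatou: "(\<integral>\<^sup>+x. ennreal ((cmod (s n x - g x))\<^sup>2) \<partial>M) \<le> ennreal e"
    if N: "\<And>j. j \<ge> N \<Longrightarrow> (LINT x|M. (cmod (s n x - s j x))\<^sup>2) < e" for n N e
  proof -
    have "(\<integral>\<^sup>+x. ennreal ((cmod (s n x - g x))\<^sup>2) \<partial>M) \<le>
        (\<integral>\<^sup>+x. liminf (\<lambda>i. ennreal ((cmod (s n x - s (r i) x))\<^sup>2)) \<partial>M)"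
    proof (rule nn_integral_mono_AE)
      show "AE x in M. ennreal ((cmod (s n x - g x))\<^sup>2) \<le>
          liminf (\<lambda>i. ennreal ((cmod (s n x - s (r i) x))\<^sup>2))"
        using conv
      proof eventually_elim
        case (elim x)
        then have "(\<lambda>i. ennreal ((cmod (s n x - s (r i) x))\<^sup>2)) \<longlonglongrightarrow> ennreal ((cmod (s n x - g x))\<^sup>2)"
          by (intro tendsto_intros)
        then show ?case using lim_imp_Liminf[OF sequentially_bot] by fastforce
      qed
    qed
    also have "\<dots> \<le> liminf (\<lambda>i. \<integral>\<^sup>+x. ennreal ((cmod (s n x - s (r i) x))\<^sup>2) \<partial>M)"
      by (rule nn_integral_liminf) auto
    also have "\<dots> \<le> ennreal e"
    proof (rule Liminf_le)
      show "\<forall>\<^sub>F i in sequentially. (\<integral>\<^sup>+x. ennreal ((cmod (s n x - s (r i) x))\<^sup>2) \<partial>M) \<le> ennreal e"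
        using eventually_ge_at_top[of N]
      proof eventually_elim
        case (elim i)
        then have "r i \<ge> N" using seq_suble[OF r(1), of i] by linarith
        then show ?case
          using N[of "r i"]
          by (subst nn_integral_eq_integral[OF square_integrable_norm_sq[OF sqd]]) (auto intro: ennreal_leI)
      qed
    qed auto
    finally show ?thesis .
  qed
  have diff: "square_integrable M (\<lambda>x. s n x - g x) \<and> (LINT x|M. (cmod (s n x - g x))\<^sup>2) \<le> e"
    if N: "\<And>j. j \<ge> N \<Longrightarrow> (LINT x|M. (cmod (s n x - s j x))\<^sup>2) < e" and e: "e > 0" for n N e
  proof
    have f: "(\<integral>\<^sup>+x. ennreal ((cmod (s n x - g x))\<^sup>2) \<partial>M) \<le> ennreal e"
      by (rule fatou) (rule N)
    have i: "integrable M (\<lambda>x. (cmod (s n x - g x))\<^sup>2)"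
    proof (rule integrableI_bounded)
      show "(\<integral>\<^sup>+x. ennreal (norm ((cmod (s n x - g x))\<^sup>2)) \<partial>M) < \<infinity>"
        using f by (simp add: order_le_less_trans)
    qed auto
    then show "square_integrable M (\<lambda>x. s n x - g x)" by (simp add: square_integrable_def)
    show "(LINT x|M. (cmod (s n x - g x))\<^sup>2) \<le> e"
      using f nn_integral_eq_integral[OF i] e by simp
  qed
  have sqg: "square_integrable M g"
  proof -
    obtain N where "\<forall>i\<ge>N. \<forall>j\<ge>N. (LINT x|M. (cmod (s i x - s j x))\<^sup>2) < 1"
      using cauchy[of 1] by auto
    then have "square_integrable M (\<lambda>x. s N x - g x)" using diff[of N N 1] by auto
    from square_integrable_diff[OF sq[of N] this] show ?thesis by simp
  qed
  moreover have "(\<lambda>n. LINT x|M. (cmod (s n x - g x))\<^sup>2) \<longlonglongrightarrow> 0"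
  proof (rule LIMSEQ_I)
    fix e :: real assume "e > 0"
    then obtain N where "\<forall>i\<ge>N. \<forall>j\<ge>N. (LINT x|M. (cmod (s i x - s j x))\<^sup>2) < e / 2"
      using cauchy[of "e / 2"] by auto
    then have "(LINT x|M. (cmod (s n x - g x))\<^sup>2) \<le> e / 2" if "n \<ge> N" for n
      using diff[of N n "e / 2"] \<open>e > 0\<close> that by auto
    then show "\<exists>N. \<forall>n\<ge>N. norm ((LINT x|M. (cmod (s n x - g x))\<^sup>2) - 0) < e"
      using \<open>e > 0\<close> by (intro exI[of _ N]) fastforce
  qed
  ultimately show ?thesis
    using sq that by (auto simp: L2_tendsto_def)
qed

lemma L2_tendsto_norm_sq:
  assumes "L2_tendsto M s g"
  shows "(\<lambda>n. LINT x|M. (cmod (s n x))\<^sup>2) \<longlonglongrightarrow> (LINT x|M. (cmod (g x))\<^sup>2)"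
proof -
  have "(LINT x|M. h x * cnj (h x)) = complex_of_real (LINT x|M. (cmod (h x))\<^sup>2)" for h
    by (simp add: complex_norm_square[symmetric] del: of_real_power)
  then show ?thesis
    using L2_tendsto_integral_mult[OF assms L2_tendsto_cnj[OF assms]] by (simp add: tendsto_of_real_iff)
qed

text \<open>Solved for the difference, since this is the form that minimisation uses: if
  \<open>a\<close> and \<open>b\<close> are almost minimal and their midpoint is a competitor, the
  right side is small.\<close>

lemma integral_parallelogram:
  assumes a: "square_integrable M a" and b: "square_integrable M b"
  shows "(LINT x|M. (cmod (a x - b x))\<^sup>2) =
    2 * (LINT x|M. (cmod (a x))\<^sup>2) + 2 * (LINT x|M. (cmod (b x))\<^sup>2) - 4 * (LINT x|M. (cmod ((a x + b x) / 2))\<^sup>2)"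
proof -
  have p: "(cmod (u - v))\<^sup>2 = 2 * (cmod u)\<^sup>2 + 2 * (cmod v)\<^sup>2 - 4 * (cmod ((u + v) / 2))\<^sup>2" for u v
    unfolding norm_divide power_divide cmod_power2 by (simp add: power2_eq_square algebra_simps)
  have "square_integrable M (\<lambda>x. (1 / 2) * (a x + b x))"
    by (intro square_integrable_cmult square_integrable_add a b)
  then have "integrable M (\<lambda>x. (cmod ((a x + b x) / 2))\<^sup>2)"
    using square_integrable_norm_sq by fastforce
  then show ?thesis
    using a b by (subst p) (simp add: square_integrable_def)
qed

text \<open>Equality is asked on the space of the measure only. This is what allows identities
  special to the circle, such as \<open>z * cnj z = 1\<close>, to be applied to the terms of a
  sequence.\<close>

lemma L2_tendsto_cong:
  assumes "L2_tendsto M s g" "\<And>n x. x \<in> space M \<Longrightarrow> s' n x = s n x" "\<And>x. x \<in> space M \<Longrightarrow> g' x = g x"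
  shows "L2_tendsto M s' g'"
proof -
  have sq: "square_integrable M h' \<longleftrightarrow> square_integrable M h" if "\<And>x. x \<in> space M \<Longrightarrow> h' x = h x" for h h'
    using that unfolding square_integrable_def
    by (simp cong: measurable_cong Bochner_Integration.integrable_cong)
  have "square_integrable M (s' n) \<longleftrightarrow> square_integrable M (s n)" for n
    by (rule sq) (rule assms(2))
  moreover have "square_integrable M g' \<longleftrightarrow> square_integrable M g"
    by (rule sq) (rule assms(3))
  moreover have "(LINT x|M. (cmod (s' n x - g' x))\<^sup>2) = (LINT x|M. (cmod (s n x - g x))\<^sup>2)" for n
    by (rule Bochner_Integration.integral_cong) (use assms in auto)
  ultimately show ?thesis
    using assms(1) by (simp add: L2_tendsto_def)
qed

lemma L2_tendsto_add:
  assumes a: "L2_tendsto M s a" and b: "L2_tendsto M t b"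
  shows "L2_tendsto M (\<lambda>n x. s n x + t n x) (\<lambda>x. a x + b x)"
  unfolding L2_tendsto_def
proof (intro conjI allI)
  have sq: "square_integrable M (s n)" "square_integrable M (t n)"
    "square_integrable M a" "square_integrable M b" for n
    using a b by (auto simp: L2_tendsto_def)
  show "square_integrable M (\<lambda>x. s n x + t n x)" "square_integrable M (\<lambda>x. a x + b x)" for n
    by (intro square_integrable_add sq)+
  note sqd = square_integrable_diff[OF sq(1,3)] square_integrable_diff[OF sq(2,4)]
  have bound: "(LINT x|M. (cmod ((s n x + t n x) - (a x + b x)))\<^sup>2) \<le>
      2 * (LINT x|M. (cmod (s n x - a x))\<^sup>2) + 2 * (LINT x|M. (cmod (t n x - b x))\<^sup>2)" for n
  proof -
    have "(LINT x|M. (cmod ((s n x + t n x) - (a x + b x)))\<^sup>2) \<le>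
        (LINT x|M. 2 * (cmod (s n x - a x))\<^sup>2 + 2 * (cmod (t n x - b x))\<^sup>2)"
    proof (rule integral_mono)
      show "integrable M (\<lambda>x. (cmod ((s n x + t n x) - (a x + b x)))\<^sup>2)"
        by (intro square_integrable_norm_sq square_integrable_diff square_integrable_add sq)
      show "(cmod ((s n x + t n x) - (a x + b x)))\<^sup>2 \<le> 2 * (cmod (s n x - a x))\<^sup>2 + 2 * (cmod (t n x - b x))\<^sup>2" for x
        using norm_add_sq_le[of "s n x - a x" "t n x - b x"] by (simp add: algebra_simps)
    qed (use square_integrable_norm_sq[OF sqd(1)] square_integrable_norm_sq[OF sqd(2)] in simp)
    also have "\<dots> = 2 * (LINT x|M. (cmod (s n x - a x))\<^sup>2) + 2 * (LINT x|M. (cmod (t n x - b x))\<^sup>2)"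
      using square_integrable_norm_sq[OF sqd(1)] square_integrable_norm_sq[OF sqd(2)] by simp
    finally show ?thesis .
  qed
  have lim: "(\<lambda>n. 2 * (LINT x|M. (cmod (s n x - a x))\<^sup>2) + 2 * (LINT x|M. (cmod (t n x - b x))\<^sup>2)) \<longlonglongrightarrow> 2 * 0 + 2 * 0"
    using a b by (intro tendsto_intros) (auto simp: L2_tendsto_def)
  show "(\<lambda>n. LINT x|M. (cmod ((s n x + t n x) - (a x + b x)))\<^sup>2) \<longlonglongrightarrow> 0"
    by (rule tendsto_sandwich[OF _ _ tendsto_const lim[simplified]]) (simp_all add: bound)
qed

lemma L2_tendsto_cmult: "L2_tendsto M s g \<Longrightarrow> L2_tendsto M (\<lambda>n x. c * s n x) (\<lambda>x. c * g x)"
  by (rule L2_tendsto_bounded_mult[where B = "cmod c"]) auto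

lemma L2_tendsto_diff:
  assumes "L2_tendsto M s a" "L2_tendsto M t b"
  shows "L2_tendsto M (\<lambda>n x. s n x - t n x) (\<lambda>x. a x - b x)"
  using L2_tendsto_add[OF assms(1) L2_tendsto_cmult[OF assms(2), of "-1"]] by simp

text \<open>Makes the constraint on \<open>J\<close> a closed condition: a subsequence converges
  almost everywhere, and the countably many exceptional sets have a null union.\<close>

lemma L2_tendsto_AE_bounded:
  assumes "L2_tendsto M s g" and b: "\<And>n. AE x in M. x \<in> J \<longrightarrow> cmod (s n x) \<le> B"
  shows "AE x in M. x \<in> J \<longrightarrow> cmod (g x) \<le> B"
proof -
  obtain r where r: "AE x in M. (\<lambda>n. s (r n) x) \<longlonglongrightarrow> g x"
    by (rule L2_tendsto_AE_subseq[OF assms(1)])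
  have "AE x in M. \<forall>n. x \<in> J \<longrightarrow> cmod (s n x) \<le> B"
    unfolding AE_all_countable using b by blast
  with r show ?thesis
  proof eventually_elim
    case (elim x)
    then show ?case by (auto intro!: LIMSEQ_le_const2[OF tendsto_norm[OF elim(1)]])
  qed
qed

lemma AE_zero_if_L2_norm_zero:
  assumes "square_integrable M g" "(LINT x|M. (cmod (g x))\<^sup>2) \<le> 0"
  shows "AE x in M. g x = 0"
proof -
  have "(LINT x|M. (cmod (g x))\<^sup>2) = 0"
    using assms(2) by (intro antisym) simp_all
  then have "AE x in M. (cmod (g x))\<^sup>2 = 0"
    using square_integrable_norm_sq[OF assms(1)] by (simp add: integral_nonneg_eq_0_iff_AE)
  then show ?thesis by simp
qed

section \<open>Restriction to a set as multiplication by its indicator\<close>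

lemma of_bool_measurable:
  "I \<in> sets M \<Longrightarrow> (\<lambda>z. of_bool (z \<in> I) :: complex) \<in> borel_measurable M"
  unfolding of_bool_def by (intro measurable_If_set) (use sets.Int_space_eq2 in fastforce)+

lemma square_integrable_of_bool_mult:
  "square_integrable M g \<Longrightarrow> I \<in> sets M \<Longrightarrow> square_integrable M (\<lambda>z. of_bool (z \<in> I) * g z)"
  by (rule square_integrable_bounded_mult[OF _ of_bool_measurable, where B = 1]) auto

lemma L2_tendsto_of_bool_mult:
  "L2_tendsto M s g \<Longrightarrow> I \<in> sets M \<Longrightarrow>
    L2_tendsto M (\<lambda>n z. of_bool (z \<in> I) * s n z) (\<lambda>z. of_bool (z \<in> I) * g z)"
  by (rule L2_tendsto_bounded_mult[OF _ of_bool_measurable, where B = 1]) auto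

section \<open>Best approximation under a constraint on the complement\<close>

text \<open>This is the parallelogram identity for the residuals \<open>f - g\<close> and
  \<open>f - h\<close>: \<open>f\<close> cancels in their difference, and their midpoint is the
  residual of the midpoint. Taking \<open>f = 0\<close> gives the same identity for plain
  norms.\<close>

lemma integral_parallelogram_restricted:
  assumes I: "I \<in> sets M" and f: "square_integrable M (\<lambda>z. of_bool (z \<in> I) * f z)"
    and g: "square_integrable M g" "square_integrable M h"
  shows "(LINT z|M. (cmod (of_bool (z \<in> I) * (g z - h z)))\<^sup>2) =
    2 * (LINT z|M. (cmod (of_bool (z \<in> I) * (f z - g z)))\<^sup>2) +
    2 * (LINT z|M. (cmod (of_bool (z \<in> I) * (f z - h z)))\<^sup>2) -
    4 * (LINT z|M. (cmod (of_bool (z \<in> I) * (f z - (g z + h z) / 2)))\<^sup>2)"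
proof -
  have sq: "square_integrable M (\<lambda>z. of_bool (z \<in> I) * (f z - g' z))"
    if "square_integrable M g'" for g'
    using square_integrable_diff[OF f square_integrable_of_bool_mult[OF that I]]
    by (simp add: right_diff_distrib)
  have a: "cmod (of_bool (z \<in> I) * (f z - g z) - of_bool (z \<in> I) * (f z - h z)) =
      cmod (of_bool (z \<in> I) * (g z - h z))" for z
    by (simp add: of_bool_def norm_minus_commute)
  have b: "(of_bool (z \<in> I) * (f z - g z) + of_bool (z \<in> I) * (f z - h z)) / 2 =
      of_bool (z \<in> I) * (f z - (g z + h z) / 2)" for z
    by (simp add: of_bool_def field_simps)
  show ?thesis
    using integral_parallelogram[OF sq[OF g(1)] sq[OF g(2)]] unfolding a b .
qed

text \<open>A common frame for both problems, with \<open>C\<close> the admissible Hardy functions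
  or the admissible polynomial functions. Midpoints are what the parallelogram identity asks for.
  Closedness is stated up to a null set because an L2 limit of polynomials agrees with a polynomial
  only almost everywhere.\<close>

locale restricted_approximation = finite_measure M for M :: "'a measure" +
  fixes I J :: "'a set" and f :: "'a \<Rightarrow> complex" and C :: "('a \<Rightarrow> complex) set"
  assumes I: "I \<in> sets M" and J: "J \<in> sets M" and cover: "I \<union> J = space M"
    and f: "square_integrable M (\<lambda>z. of_bool (z \<in> I) * f z)"
    and C_sq: "\<And>g. g \<in> C \<Longrightarrow> square_integrable M g"
    and C_mid: "\<And>g h. g \<in> C \<Longrightarrow> h \<in> C \<Longrightarrow> (\<lambda>z. (g z + h z) / 2) \<in> C"
    and C_bdd: "\<And>g. g \<in> C \<Longrightarrow> AE z in M. z \<in> J \<longrightarrow> cmod (g z) \<le> 1"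
    and C_ne: "C \<noteq> {}"
    and C_closed: "\<And>s g. L2_tendsto M s g \<Longrightarrow> (\<And>n. s n \<in> C) \<Longrightarrow> \<exists>g'\<in>C. AE z in M. g' z = g z"
begin

definition dist_sq :: "('a \<Rightarrow> complex) \<Rightarrow> real" where
  "dist_sq g = (LINT z|M. (cmod (of_bool (z \<in> I) * (f z - g z)))\<^sup>2)"

definition size_sq :: "('a \<Rightarrow> complex) \<Rightarrow> real" where
  "size_sq g = (LINT z|M. (cmod (of_bool (z \<in> J) * g z))\<^sup>2)"

lemma dist_sq_nonneg: "0 \<le> dist_sq g"
  by (simp add: dist_sq_def)

lemma size_sq_nonneg: "0 \<le> size_sq g"
  by (simp add: size_sq_def)

lemma dist_sq_diff:
  assumes "g \<in> C" "h \<in> C"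
  shows "(LINT z|M. (cmod (of_bool (z \<in> I) * (g z - h z)))\<^sup>2) =
    2 * dist_sq g + 2 * dist_sq h - 4 * dist_sq (\<lambda>z. (g z + h z) / 2)"
  unfolding dist_sq_def by (rule integral_parallelogram_restricted[OF I f C_sq C_sq]) fact+

lemma size_sq_diff:
  assumes "g \<in> C" "h \<in> C"
  shows "(LINT z|M. (cmod (of_bool (z \<in> J) * (g z - h z)))\<^sup>2) =
    2 * size_sq g + 2 * size_sq h - 4 * size_sq (\<lambda>z. (g z + h z) / 2)"
  using integral_parallelogram_restricted[OF J _ C_sq[OF assms(1)] C_sq[OF assms(2)], of "\<lambda>_. 0"]
  by (simp add: size_sq_def square_integrable_def norm_mult)

lemma dist_sq_midpoint:
  assumes "g \<in> C" "h \<in> C" "dist_sq g \<le> c" "dist_sq h \<le> c"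
  shows "dist_sq (\<lambda>z. (g z + h z) / 2) \<le> c"
proof -
  have "0 \<le> (LINT z|M. (cmod (of_bool (z \<in> I) * (g z - h z)))\<^sup>2)" by simp
  then show ?thesis using dist_sq_diff[OF assms(1,2)] assms(3,4) by linarith
qed

lemma size_sq_le: "g \<in> C \<Longrightarrow> size_sq g \<le> measure M (space M)"
proof -
  assume g: "g \<in> C"
  have "size_sq g \<le> (LINT z|M. 1)"
    unfolding size_sq_def
  proof (rule integral_mono_AE)
    show "integrable M (\<lambda>z. (cmod (of_bool (z \<in> J) * g z))\<^sup>2)"
      by (rule square_integrable_norm_sq[OF square_integrable_of_bool_mult[OF C_sq[OF g] J]])
    show "AE z in M. (cmod (of_bool (z \<in> J) * g z))\<^sup>2 \<le> 1"
      using C_bdd[OF g] by eventually_elim (auto simp: power_le_one)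
  qed simp
  then show ?thesis by simp
qed

lemma split_norm_sq:
  assumes "square_integrable M g"
  shows "(LINT z|M. (cmod (g z))\<^sup>2) \<le>
    (LINT z|M. (cmod (of_bool (z \<in> I) * g z))\<^sup>2) + (LINT z|M. (cmod (of_bool (z \<in> J) * g z))\<^sup>2)"
proof -
  have i: "integrable M (\<lambda>z. (cmod (of_bool (z \<in> I) * g z))\<^sup>2)"
    "integrable M (\<lambda>z. (cmod (of_bool (z \<in> J) * g z))\<^sup>2)"
    using square_integrable_of_bool_mult[OF assms I] square_integrable_of_bool_mult[OF assms J]
    by (simp_all only: square_integrable_def)
  have "(LINT z|M. (cmod (g z))\<^sup>2) \<le>
      (LINT z|M. (cmod (of_bool (z \<in> I) * g z))\<^sup>2 + (cmod (of_bool (z \<in> J) * g z))\<^sup>2)"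
  proof (rule integral_mono)
    fix z assume "z \<in> space M"
    then show "(cmod (g z))\<^sup>2 \<le> (cmod (of_bool (z \<in> I) * g z))\<^sup>2 + (cmod (of_bool (z \<in> J) * g z))\<^sup>2"
      using cover by auto
  qed (use i assms in \<open>auto simp: square_integrable_def\<close>)
  also have "\<dots> = (LINT z|M. (cmod (of_bool (z \<in> I) * g z))\<^sup>2) + (LINT z|M. (cmod (of_bool (z \<in> J) * g z))\<^sup>2)"
    using i by simp
  finally show ?thesis .
qed

text \<open>A sequence minimising the distance to \<open>f\<close> on \<open>I\<close> is Cauchy only on \<open>I\<close>. It becomes Cauchy
  on \<open>J\<close> too if each term is also chosen almost minimal on \<open>J\<close> among the competitors of its quality;
  this replaces a weak compactness argument.\<close>

lemma best_approximation_exists: "\<exists>g\<in>C. \<forall>h\<in>C. dist_sq g \<le> dist_sq h"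
proof -
  define \<epsilon> where "\<epsilon> n = 1 / real (Suc n)" for n
  have \<epsilon>: "0 < \<epsilon> n" for n by (simp add: \<epsilon>_def)
  have \<epsilon>_mono: "\<epsilon> n \<le> \<epsilon> m" if "m \<le> n" for m n using that by (simp add: \<epsilon>_def frac_le)
  have \<epsilon>_lim: "\<epsilon> \<longlonglongrightarrow> 0" unfolding \<epsilon>_def by (rule LIMSEQ_Suc[OF lim_1_over_n])
  define d where "d = (INF g\<in>C. dist_sq g)"
  have d: "d \<le> dist_sq g" if "g \<in> C" for g
    unfolding d_def by (intro cINF_lower bdd_belowI2[where m = 0] dist_sq_nonneg that)
  \<comment> \<open>The competitors of quality \<open>n\<close>. These sets are nonempty, decreasing
    in \<open>n\<close> and closed under midpoints.\<close>
  define D where "D n = {g \<in> C. dist_sq g \<le> d + \<epsilon> n}" for n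
  have D_ne: "D n \<noteq> {}" for n
  proof -
    have "\<exists>x\<in>dist_sq ` C. x < d + \<epsilon> n"
      using C_ne \<epsilon>[of n] by (intro cInf_lessD) (auto simp: d_def)
    then show ?thesis by (auto simp: D_def intro: less_imp_le)
  qed
  have D_mono: "D n \<subseteq> D m" if "m \<le> n" for m n
    using \<epsilon>_mono[OF that] by (auto simp: D_def)
  have D_mid: "(\<lambda>z. (g z + h z) / 2) \<in> D n" if "g \<in> D n" "h \<in> D n" for g h n
    using that by (auto simp: D_def intro: C_mid dist_sq_midpoint)
  \<comment> \<open>As the sets \<open>D n\<close> shrink, \<open>e n\<close> increases, and the
    constraint on \<open>J\<close> bounds it by the total mass. Its convergence is what will control
    the sequence on \<open>J\<close>.\<close>
  define e where "e n = (INF g\<in>D n. size_sq g)" for n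
  have e: "e n \<le> size_sq g" if "g \<in> D n" for g n
    unfolding e_def by (intro cINF_lower bdd_belowI2[where m = 0] size_sq_nonneg that)
  have e_mono: "incseq e"
    unfolding e_def
    by (intro incseq_SucI cINF_superset_mono D_ne D_mono bdd_belowI2[where m = 0] size_sq_nonneg) auto
  have "e n \<le> measure M (space M)" for n
  proof -
    obtain g where "g \<in> D n" using D_ne by blast
    then show ?thesis using e[of g n] size_sq_le[of g] by (simp add: D_def)
  qed
  then obtain L where L: "e \<longlonglongrightarrow> L" "\<forall>n. e n \<le> L"
    using incseq_convergent[OF e_mono] by metis
  have "\<exists>g\<in>D n. size_sq g < e n + \<epsilon> n" for n
  proof -
    have "\<exists>x\<in>size_sq ` D n. x < e n + \<epsilon> n"
      using D_ne \<epsilon>[of n] by (intro cInf_lessD) (auto simp: e_def)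
    then show ?thesis by auto
  qed
  then obtain s where s: "\<And>n. s n \<in> D n" "\<And>n. size_sq (s n) < e n + \<epsilon> n" by metis
  have sC: "s n \<in> C" for n using s(1) by (auto simp: D_def)
  \<comment> \<open>Both terms and their midpoint lie in \<open>D m\<close>. The identity on
    \<open>I\<close> then contributes at most \<open>4 * \<epsilon> m\<close>, and the identity on
    \<open>J\<close> at most \<open>2 * (L - e m) + 4 * \<epsilon> m\<close>.\<close>
  have bound: "(LINT z|M. (cmod (s m z - s n z))\<^sup>2) \<le> 2 * (L - e m) + 8 * \<epsilon> m" if "m \<le> n" for m n
  proof -
    have mem: "s m \<in> D m" "s n \<in> D m" using s(1) D_mono[OF that] by auto
    define k where "k = (\<lambda>z. (s m z + s n z) / 2)"
    have k: "k \<in> D m" unfolding k_def by (rule D_mid[OF mem])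
    have "(LINT z|M. (cmod (s m z - s n z))\<^sup>2) \<le>
      (2 * dist_sq (s m) + 2 * dist_sq (s n) - 4 * dist_sq k) +
      (2 * size_sq (s m) + 2 * size_sq (s n) - 4 * size_sq k)"
      using split_norm_sq[OF square_integrable_diff[OF C_sq[OF sC] C_sq[OF sC]], of m n]
      unfolding dist_sq_diff[OF sC sC, folded k_def] size_sq_diff[OF sC sC, folded k_def] k_def .
    moreover have "d \<le> dist_sq k" using k by (auto simp: D_def intro: d)
    moreover have "e m \<le> size_sq k" by (rule e[OF k])
    moreover have "dist_sq (s m) \<le> d + \<epsilon> m" "dist_sq (s n) \<le> d + \<epsilon> m"
      using mem by (auto simp: D_def)
    moreover have "size_sq (s n) \<le> L + \<epsilon> m"
      using s(2)[of n] L(2)[rule_format, of n] \<epsilon>_mono[OF that] by linarith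
    ultimately show ?thesis using s(2)[of m] by (simp add: algebra_simps)
  qed
  have "\<exists>N. \<forall>i\<ge>N. \<forall>j\<ge>N. (LINT z|M. (cmod (s i z - s j z))\<^sup>2) < r" if r: "r > 0" for r
  proof -
    have "(\<lambda>m. 2 * (L - e m) + 8 * \<epsilon> m) \<longlonglongrightarrow> 2 * (L - L) + 8 * 0"
      by (intro tendsto_intros L \<epsilon>_lim)
    then have "\<forall>\<^sub>F m in sequentially. 2 * (L - e m) + 8 * \<epsilon> m < r"
      using r by (intro order_tendstoD(2)) auto
    then obtain N where N: "\<And>m. m \<ge> N \<Longrightarrow> 2 * (L - e m) + 8 * \<epsilon> m < r"
      by (auto simp: eventually_sequentially)
    have "(LINT z|M. (cmod (s i z - s j z))\<^sup>2) < r" if ij: "i \<ge> N" "j \<ge> N" for i j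
    proof (cases "i \<le> j")
      case True
      then show ?thesis using bound[OF True] N[OF ij(1)] by linarith
    next
      case False
      then have "(LINT z|M. (cmod (s j z - s i z))\<^sup>2) < r"
        using bound[of j i] N[OF ij(2)] by linarith
      then show ?thesis by (simp add: norm_minus_commute)
    qed
    then show ?thesis by blast
  qed
  then obtain g where g: "L2_tendsto M s g"
    using L2_complete[of s] C_sq[OF sC] by metis
  obtain g' where g': "g' \<in> C" "AE z in M. g' z = g z"
    using C_closed[OF g sC] by blast
  have sq_g: "square_integrable M g" using g by (simp add: L2_tendsto_def)
  have "dist_sq g' = dist_sq g"
    unfolding dist_sq_def
  proof (rule integral_cong_AE)
    have "square_integrable M (\<lambda>z. of_bool (z \<in> I) * (f z - h z))" if "square_integrable M h" for h
      using square_integrable_diff[OF f square_integrable_of_bool_mult[OF that I]]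
      by (simp add: right_diff_distrib)
    then show "(\<lambda>z. (cmod (of_bool (z \<in> I) * (f z - g' z)))\<^sup>2) \<in> borel_measurable M"
      "(\<lambda>z. (cmod (of_bool (z \<in> I) * (f z - g z)))\<^sup>2) \<in> borel_measurable M"
      using C_sq[OF g'(1)] sq_g square_integrable_norm_sq borel_measurable_integrable by blast+
    show "AE z in M. (cmod (of_bool (z \<in> I) * (f z - g' z)))\<^sup>2 = (cmod (of_bool (z \<in> I) * (f z - g z)))\<^sup>2"
      using g'(2) by eventually_elim simp
  qed
  also have "dist_sq g \<le> d"
  proof (rule LIMSEQ_le)
    have "L2_tendsto M (\<lambda>n z. of_bool (z \<in> I) * (f z - s n z)) (\<lambda>z. of_bool (z \<in> I) * (f z - g z))"
      using L2_tendsto_diff[OF L2_tendsto_const[OF f] L2_tendsto_of_bool_mult[OF g I]]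
      by (simp add: right_diff_distrib)
    from L2_tendsto_norm_sq[OF this] show "(\<lambda>n. dist_sq (s n)) \<longlonglongrightarrow> dist_sq g"
      by (simp add: dist_sq_def)
    have "(\<lambda>n. d + \<epsilon> n) \<longlonglongrightarrow> d + 0" by (intro tendsto_intros \<epsilon>_lim)
    then show "(\<lambda>n. d + \<epsilon> n) \<longlonglongrightarrow> d" by simp
    show "\<exists>N. \<forall>n\<ge>N. dist_sq (s n) \<le> d + \<epsilon> n" using s(1) by (auto simp: D_def)
  qed
  finally have "\<forall>h\<in>C. dist_sq g' \<le> dist_sq h" using d order_trans by blast
  with g'(1) show ?thesis by blast
qed

text \<open>Two minimisers that differ on \<open>I\<close> would have a strictly better midpoint.
  The distance does not see \<open>J\<close>; agreement there has to come from analyticity.\<close>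

lemma best_approximation_unique:
  assumes g: "g \<in> C" "\<forall>k\<in>C. dist_sq g \<le> dist_sq k" and h: "h \<in> C" "\<forall>k\<in>C. dist_sq h \<le> dist_sq k"
  shows "AE z in M. z \<in> I \<longrightarrow> g z = h z"
proof -
  have "dist_sq g \<le> dist_sq (\<lambda>z. (g z + h z) / 2)" "dist_sq h \<le> dist_sq (\<lambda>z. (g z + h z) / 2)"
    using assms C_mid by blast+
  then have "(LINT z|M. (cmod (of_bool (z \<in> I) * (g z - h z)))\<^sup>2) \<le> 0"
    using dist_sq_diff[OF g(1) h(1)] by linarith
  moreover have "square_integrable M (\<lambda>z. of_bool (z \<in> I) * (g z - h z))"
    by (intro square_integrable_of_bool_mult square_integrable_diff C_sq g h I)
  ultimately have "AE z in M. of_bool (z \<in> I) * (g z - h z) = 0"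
    by (intro AE_zero_if_L2_norm_zero)
  then show ?thesis by eventually_elim auto
qed

end

section \<open>Fourier analysis on the circle\<close>

interpretation circle: prob_space circle_measure
  by (rule prob_space_circle_measure)

lemma borel_measurable_circle:
  assumes "continuous_on unit_circle h"
  shows "h \<in> borel_measurable circle_measure"
  using borel_measurable_continuous_on_restrict[OF assms]
  by (simp add: measurable_cong_sets[OF sets_circle_measure refl])

lemma borel_set_circle: "A \<in> sets borel \<Longrightarrow> A \<inter> unit_circle \<in> sets circle_measure"
  by (auto simp: sets_circle_measure sets_restrict_space)

lemma AE_circle: "AE z in circle_measure. cmod z = 1"
  using AE_space[of circle_measure] by simp

lemma mult_cnj_circle: "cmod z = 1 \<Longrightarrow> z * cnj z = 1"
  by (simp add: complex_norm_square[symmetric])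

lemma continuous_circle_bound:
  fixes h :: "complex \<Rightarrow> complex"
  assumes "continuous_on unit_circle h"
  obtains B where "AE z in circle_measure. cmod (h z) \<le> B"
proof -
  have "bounded (h ` unit_circle)"
    using assms by (intro compact_imp_bounded compact_continuous_image) auto
  then obtain B where "\<And>z. z \<in> unit_circle \<Longrightarrow> cmod (h z) \<le> B"
    unfolding bounded_iff by blast
  then have "AE z in circle_measure. cmod (h z) \<le> B"
    by (intro AE_I2) simp
  then show ?thesis by (rule that)
qed

lemma square_integrable_circle:
  fixes h :: "complex \<Rightarrow> complex"
  assumes "continuous_on unit_circle h"
  shows "square_integrable circle_measure h"
  using continuous_circle_bound[OF assms] circle.square_integrable_AE_bounded borel_measurable_circle[OF assms]
  by metis

lemma integrable_circle_mult:
  fixes h g :: "complex \<Rightarrow> complex"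
  assumes h: "continuous_on unit_circle h" and g: "integrable circle_measure g"
  shows "integrable circle_measure (\<lambda>z. h z * g z)"
proof -
  obtain B where B: "AE z in circle_measure. cmod (h z) \<le> B"
    by (rule continuous_circle_bound[OF h])
  show ?thesis
  proof (rule Bochner_Integration.integrable_bound)
    show "integrable circle_measure (\<lambda>z. B * cmod (g z))" using g by simp
    show "AE z in circle_measure. norm (h z * g z) \<le> norm (B * cmod (g z))"
      using B
    proof eventually_elim
      case (elim z)
      then have "cmod (h z) * cmod (g z) \<le> B * cmod (g z)" by (simp add: mult_right_mono)
      then show ?case by (simp add: norm_mult)
    qed
  qed (use g borel_measurable_circle[OF h] in auto)
qed

section \<open>Orthogonality of powers and trigonometric approximation\<close>

lemma integral_circle_power:
  "(LINT z|circle_measure. z ^ k) = (if k = 0 then 1 else 0)"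
proof (cases "k = 0")
  case False
  define F where "F = (\<lambda>\<theta>::real. exp (\<i> * of_nat k * of_real \<theta>) / (\<i> * of_nat k))"
  have i: "set_integrable lborel {0..2 * pi} (\<lambda>\<theta>. cis \<theta> ^ k)"
    by (intro borel_integrable_atLeastAtMost' continuous_intros)
  have "((\<lambda>\<theta>. cis \<theta> ^ k) has_integral (F (2 * pi) - F 0)) {0..2 * pi}"
  proof (rule fundamental_theorem_of_calculus)
    fix \<theta> :: real
    have "(F has_vector_derivative exp (\<i> * of_nat k * of_real \<theta>)) (at \<theta> within {0..2*pi})"
      unfolding F_def using False
      by (auto intro!: derivative_eq_intros has_vector_derivative_real_field)
    then show "(F has_vector_derivative cis \<theta> ^ k) (at \<theta> within {0..2*pi})"
      by (simp add: cis_conv_exp exp_of_nat_mult[symmetric] mult_ac)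
  qed simp
  moreover have "F (2 * pi) - F 0 = 0"
  proof -
    have "exp (\<i> * of_nat k * of_real (2 * pi)) = exp (2 * of_int (int k) * pi * \<i>)"
      by (simp add: mult_ac)
    also have "\<dots> = 1" by (rule exp_integer_2pi) simp
    finally show ?thesis by (simp add: F_def)
  qed
  ultimately have "(LBINT \<theta>:{0..2 * pi}. cis \<theta> ^ k) = 0"
    using set_borel_integral_eq_integral(2)[OF i] by (simp add: integral_unique)
  moreover have "(LBINT \<theta>:{0..<2 * pi}. cis \<theta> ^ k) = (LBINT \<theta>:{0..2 * pi}. cis \<theta> ^ k)"
  proof (rule set_integral_cong_set)
    have "AE \<theta> in lborel. \<theta> \<noteq> 2 * pi" by (rule AE_lborel_singleton)
    then show "AE \<theta> in lborel. \<theta> \<in> {0..2 * pi} \<longleftrightarrow> \<theta> \<in> {0..<2 * pi}"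
      by eventually_elim auto
    have "(\<lambda>\<theta>. cis \<theta> ^ k) \<in> borel_measurable borel"
      by (intro borel_measurable_continuous_onI continuous_intros)
    then show "set_borel_measurable lborel {0..2 * pi} (\<lambda>\<theta>. cis \<theta> ^ k)"
      "set_borel_measurable lborel {0..<2 * pi} (\<lambda>\<theta>. cis \<theta> ^ k)"
      unfolding set_borel_measurable_def by measurable
  qed
  ultimately show ?thesis
    using False by (subst integral_circle_measure) (auto intro!: borel_measurable_circle continuous_intros)
qed (simp add: circle.prob_space[unfolded space_circle_measure])

lemma integral_circle_poly: "(LINT z|circle_measure. poly p z) = coeff p 0"
proof -
  have "(LINT z|circle_measure. poly p z) = (LINT z|circle_measure. (\<Sum>i\<le>degree p. coeff p i * z ^ i))"
    by (simp add: poly_altdef)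
  also have "\<dots> = (\<Sum>i\<le>degree p. (LINT z|circle_measure. coeff p i * z ^ i))"
    by (intro Bochner_Integration.integral_sum circle.integrable_square_integrable square_integrable_circle
        continuous_intros)
  also have "\<dots> = (\<Sum>i\<le>degree p. if i = 0 then coeff p i else 0)"
    by (intro sum.cong) (simp_all add: integral_circle_power)
  also have "\<dots> = coeff p 0" by simp
  finally show ?thesis .
qed

text \<open>On the circle \<open>cnj z\<close> is \<open>1 / z\<close>, so
  \<open>cnj z ^ N * poly p z\<close> is a general trigonometric polynomial whose negative powers
  are gathered in a single factor. In this shape sums and products stay within ordinary
  polynomials.\<close>

lemma real_polynomial_function_trig:
  fixes g :: "complex \<Rightarrow> real"
  assumes "real_polynomial_function g"
  shows "\<exists>N p. \<forall>z\<in>unit_circle. complex_of_real (g z) = cnj z ^ N * poly p z"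
  using assms
proof induction
  case (linear g)
  then interpret bounded_linear g .
  \<comment> \<open>Obtained from \<open>Re z = (z + cnj z) / 2\<close> and
    \<open>Im z = \<i> * (cnj z - z) / 2\<close>. The coefficient of \<open>z\<close> moves to
    degree 2 because \<open>z = cnj z * z ^ 2\<close> on the circle.\<close>
  define p where "p = [:of_real (g 1) / 2 + \<i> * of_real (g \<i>) / 2, 0, of_real (g 1) / 2 - \<i> * of_real (g \<i>) / 2:]"
  have "complex_of_real (g z) = cnj z ^ 1 * poly p z" if z: "z \<in> unit_circle" for z
  proof -
    have zz: "z * cnj z = 1" using mult_cnj_circle z by simp
    have "z = Re z *\<^sub>R 1 + Im z *\<^sub>R \<i>" by (simp add: complex_eq_iff)
    then have "g z = Re z * g 1 + Im z * g \<i>"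
      by (metis add scaleR real_scaleR_def)
    then have "complex_of_real (g z) = of_real (Re z) * of_real (g 1) + of_real (Im z) * of_real (g \<i>)"
      by simp
    also have "complex_of_real (Re z) = (z + cnj z) / 2" by (simp add: complex_eq_iff)
    also have "complex_of_real (Im z) = \<i> * (cnj z - z) / 2" by (simp add: complex_eq_iff)
    also have "(z + cnj z) / 2 * of_real (g 1) + \<i> * (cnj z - z) / 2 * of_real (g \<i>) =
       cnj z * (of_real (g 1) / 2 + \<i> * of_real (g \<i>) / 2) +
       z * (of_real (g 1) / 2 - \<i> * of_real (g \<i>) / 2)"
      by (simp add: field_simps)
    also have "\<dots> = cnj z * (of_real (g 1) / 2 + \<i> * of_real (g \<i>) / 2) +
       (z * cnj z) * z * (of_real (g 1) / 2 - \<i> * of_real (g \<i>) / 2)"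
      unfolding zz by simp
    also have "\<dots> = cnj z ^ 1 * poly p z" by (simp add: p_def algebra_simps)
    finally show ?thesis .
  qed
  then show ?case by blast
next
  case (const c)
  have "complex_of_real c = cnj z ^ 0 * poly [:of_real c:] z" for z by simp
  then show ?case by blast
next
  case (add f g)
  then obtain N p M q where f: "\<forall>z\<in>unit_circle. complex_of_real (f z) = cnj z ^ N * poly p z"
    and g: "\<forall>z\<in>unit_circle. complex_of_real (g z) = cnj z ^ M * poly q z" by blast
  \<comment> \<open>Common denominator: each summand is multiplied by the power that the other one
    carries.\<close>
  have "complex_of_real (f z + g z) = cnj z ^ (N + M) * poly (monom 1 M * p + monom 1 N * q) z"
    if z: "z \<in> unit_circle" for z
  proof -
    have zz: "cnj z ^ k * z ^ k = 1" for k
      using mult_cnj_circle[of z] z by (simp add: power_mult_distrib[symmetric] mult.commute)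
    have "cnj z ^ (N + M) * poly (monom 1 M * p + monom 1 N * q) z =
        cnj z ^ N * poly p z * (cnj z ^ M * z ^ M) + cnj z ^ M * poly q z * (cnj z ^ N * z ^ N)"
      by (simp add: power_add poly_monom algebra_simps)
    then show ?thesis using f g z unfolding zz by simp
  qed
  then show ?case by blast
next
  case (mult f g)
  then obtain N p M q where f: "\<forall>z\<in>unit_circle. complex_of_real (f z) = cnj z ^ N * poly p z"
    and g: "\<forall>z\<in>unit_circle. complex_of_real (g z) = cnj z ^ M * poly q z" by blast
  have "complex_of_real (f z * g z) = cnj z ^ (N + M) * poly (p * q) z"
    if z: "z \<in> unit_circle" for z
    using f g z by (simp add: power_add)
  then show ?case by blast
qed

lemma trig_poly_approximation:
  fixes \<phi> :: "complex \<Rightarrow> real"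
  assumes "continuous_on unit_circle \<phi>" "0 < e"
  obtains N p where "\<And>z. cmod z = 1 \<Longrightarrow> cmod (of_real (\<phi> z) - cnj z ^ N * poly p z) < e"
proof -
  obtain g where g: "real_polynomial_function g" "\<And>z. z \<in> unit_circle \<Longrightarrow> \<bar>\<phi> z - g z\<bar> < e"
    using Stone_Weierstrass_real_polynomial_function[OF _ assms] compact_sphere by blast
  obtain N p where "\<forall>z\<in>unit_circle. complex_of_real (g z) = cnj z ^ N * poly p z"
    using real_polynomial_function_trig[OF g(1)] by blast
  then have "cmod (of_real (\<phi> z) - cnj z ^ N * poly p z) < e" if "cmod z = 1" for z
    using g(2)[of z] that by (metis mem_sphere_0 norm_of_real of_real_diff)
  then show ?thesis by (rule that)
qed

text \<open>Continuous cutoffs give vanishing integrals over closed sets. These form an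
  intersection-stable generator of the Borel sets, so the integral vanishes over every Borel set;
  the test function 1 supplies the total integral for complements.\<close>

lemma AE_zero_if_integral_continuous:
  fixes h :: "complex \<Rightarrow> complex"
  assumes h: "integrable circle_measure h"
    and ort: "\<And>\<phi> :: complex \<Rightarrow> real. continuous_on UNIV \<phi> \<Longrightarrow>
      (LINT z|circle_measure. of_real (\<phi> z) * h z) = 0"
  shows "AE z in circle_measure. h z = 0"
proof (rule circle.density_zero[OF h])
  have [measurable]: "h \<in> borel_measurable circle_measure" using h by simp
  have int: "set_integrable circle_measure (A \<inter> unit_circle) h" if "A \<in> sets borel" for A
    using h borel_set_circle[OF that] unfolding set_integrable_def by (simp add: integrable_mult_indicator)
  have total: "(LINT z|circle_measure. h z) = 0"
    using ort[of "\<lambda>_. 1"] by simp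
  have gen: "(LINT z:C \<inter> unit_circle|circle_measure. h z) = 0" if C: "closed C" for C
  \<comment> \<open>The distance to the empty set is 0 by convention, so the cutoffs below would be
    constantly 1 in that case.\<close>
  proof (cases "C = {}")
    case False
    \<comment> \<open>Continuous, with values between 0 and 1, equal to 1 on \<open>C\<close> and
      eventually 0 at each point off the closed set \<open>C\<close>; hence \<open>|h|\<close>
      dominates the products.\<close>
    define \<phi> where "\<phi> n z = max 0 (1 - real n * infdist z C)" for n z
    have cont: "continuous_on UNIV (\<phi> n)" for n
      unfolding \<phi>_def by (intro continuous_intros)
    have lim: "(\<lambda>n. \<phi> n z) \<longlonglongrightarrow> indicator C z" for z
    proof (cases "z \<in> C")
      case True then show ?thesis by (simp add: \<phi>_def)
    next
      case z: False
      then have p: "infdist z C > 0"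
        using C False by (metis in_closed_iff_infdist_zero infdist_nonneg less_eq_real_def)
      obtain N :: nat where N: "1 / infdist z C < real N" using reals_Archimedean2 by blast
      have "\<phi> n z = 0" if "n \<ge> N" for n
      proof -
        have "1 / infdist z C < real n" using N that by linarith
        then have "1 < real n * infdist z C" using p by (simp add: field_simps)
        then show ?thesis by (simp add: \<phi>_def)
      qed
      then have "\<forall>\<^sub>F n in sequentially. \<phi> n z = indicator C z"
        using z by (auto simp: eventually_sequentially)
      then show ?thesis by (rule tendsto_eventually)
    qed
    have "(\<lambda>n. LINT z|circle_measure. of_real (\<phi> n z) * h z) \<longlonglongrightarrow>
        (LINT z|circle_measure. of_real (indicator C z) * h z)"
    proof (rule integral_dominated_convergence[where w = "\<lambda>z. cmod (h z)"])
      show "(\<lambda>z. of_real (indicator C z) * h z) \<in> borel_measurable circle_measure"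
      proof (subst measurable_cong)
        show "of_real (indicator C z) * h z = indicator (C \<inter> unit_circle) z *\<^sub>R h z"
          if "z \<in> space circle_measure" for z
          using that by (simp add: indicator_def)
      qed (use int[of C] C in \<open>auto simp: set_integrable_def\<close>)
      show "(\<lambda>z. of_real (\<phi> n z) * h z) \<in> borel_measurable circle_measure" for n
      proof -
        have "\<phi> n \<in> borel_measurable circle_measure"
          using cont[of n] continuous_on_subset by (blast intro: borel_measurable_circle)
        then show ?thesis by measurable
      qed
      show "AE z in circle_measure. (\<lambda>n. of_real (\<phi> n z) * h z) \<longlonglongrightarrow> of_real (indicator C z) * h z"
        by (intro AE_I2 tendsto_intros lim)
      show "AE z in circle_measure. norm (of_real (\<phi> n z) * h z) \<le> cmod (h z)" for n
      proof (rule AE_I2)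
        fix z
        have "\<bar>\<phi> n z\<bar> \<le> 1" by (simp add: \<phi>_def infdist_nonneg)
        then show "norm (of_real (\<phi> n z) * h z) \<le> cmod (h z)"
          by (simp add: norm_mult mult_left_le_one_le)
      qed
    qed (use h in auto)
    then have "(LINT z|circle_measure. of_real (indicator C z) * h z) = 0"
      using ort[OF cont] by (simp add: LIMSEQ_const_iff)
    also have "(LINT z|circle_measure. of_real (indicator C z) * h z) =
        (LINT z:C \<inter> unit_circle|circle_measure. h z)"
      unfolding set_lebesgue_integral_def
      by (rule Bochner_Integration.integral_cong) (auto simp: indicator_def)
    finally show ?thesis .
  qed (simp add: set_lebesgue_integral_def)
  have stable: "Int_stable (Collect closed :: complex set set)" "Collect closed \<subseteq> Pow (UNIV :: complex set)"
    by (auto simp: Int_stable_def)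
  have borel: "A \<in> sigma_sets UNIV (Collect closed) \<Longrightarrow> A \<in> sets (borel :: complex measure)" for A
    by (simp add: borel_eq_closed)
  have "(LINT z:A \<inter> unit_circle|circle_measure. h z) = 0" if "A \<in> sigma_sets UNIV (Collect closed)" for A
    using stable that
  proof (induction rule: sigma_sets_induct_disjoint)
    case (basic A) then show ?case by (simp add: gen)
  next
    case (compl A)
    have A: "A \<inter> unit_circle \<in> sets circle_measure"
      using borel_set_circle borel compl.hyps by blast
    have "(LINT z:(UNIV - A) \<inter> unit_circle|circle_measure. h z) =
        (LINT z|circle_measure. h z - indicator (A \<inter> unit_circle) z *\<^sub>R h z)"
      unfolding set_lebesgue_integral_def
      by (rule Bochner_Integration.integral_cong) (auto simp: indicator_def)
    also have "\<dots> = 0"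
      using compl.IH total h A unfolding set_lebesgue_integral_def
      by (subst Bochner_Integration.integral_diff) (auto intro: integrable_mult_indicator)
    finally show ?case .
  next
    case (union A)
    have "(LINT z:(\<Union>i. A i \<inter> unit_circle)|circle_measure. h z) =
        (\<Sum>i. (LINT z:A i \<inter> unit_circle|circle_measure. h z))"
    proof (rule lebesgue_integral_countable_add)
      show "A i \<inter> unit_circle \<in> sets circle_measure" for i
        using borel_set_circle borel union.hyps by blast
      show "(A i \<inter> unit_circle) \<inter> (A j \<inter> unit_circle) = {}" if "i \<noteq> j" for i j
        using union.hyps that by (auto simp: disjoint_family_on_def)
      show "set_integrable circle_measure (\<Union>i. A i \<inter> unit_circle) h"
      proof -
        have "(\<Union>i. A i) \<in> sets borel" using borel union.hyps by blast
        then show ?thesis using int[of "\<Union>i. A i"] by simp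
      qed
    qed
    then show ?case using union.IH by simp
  qed (auto simp: set_lebesgue_integral_def)
  then have *: "(LINT z:A \<inter> unit_circle|circle_measure. h z) = 0" if "A \<in> sets borel" for A
    using that by (simp add: borel_eq_closed)
  show "(LINT z:A|circle_measure. h z) = 0" if "A \<in> sets circle_measure" for A
  proof -
    have "A \<in> (\<inter>) unit_circle ` sets borel"
      using that by (simp only: sets_circle_measure sets_restrict_space)
    then obtain B where "A = unit_circle \<inter> B" "B \<in> sets borel" by (rule imageE)
    then show ?thesis using *[of B] by (simp add: Int_commute)
  qed
qed

lemma AE_zero_if_integral_trig_poly:
  fixes h :: "complex \<Rightarrow> complex"
  assumes h: "integrable circle_measure h"
    and ort: "\<And>N p. (LINT z|circle_measure. cnj z ^ N * poly p z * h z) = 0"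
  shows "AE z in circle_measure. h z = 0"
proof (rule AE_zero_if_integral_continuous[OF h])
  fix \<phi> :: "complex \<Rightarrow> real" assume "continuous_on UNIV \<phi>"
  then have \<phi>: "continuous_on unit_circle \<phi>" by (rule continuous_on_subset) simp
  define H where "H = (LINT z|circle_measure. cmod (h z))"
  have H: "0 \<le> H" by (simp add: H_def)
  have "cmod (LINT z|circle_measure. of_real (\<phi> z) * h z) \<le> e" if e: "e > 0" for e
  proof -
    \<comment> \<open>A uniform error \<open>e / (H + 1)\<close> changes the integral by at most
      \<open>e\<close>; the added 1 avoids division by 0.\<close>
    have p: "0 < e / (H + 1)" using e H by simp
    obtain N p where Np: "\<And>z. cmod z = 1 \<Longrightarrow> cmod (of_real (\<phi> z) - cnj z ^ N * poly p z) < e / (H + 1)"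
      by (rule trig_poly_approximation[OF \<phi> p]) blast
    have i: "integrable circle_measure (\<lambda>z. of_real (\<phi> z) * h z)"
      "integrable circle_measure (\<lambda>z. cnj z ^ N * poly p z * h z)"
      by (intro integrable_circle_mult h continuous_intros \<phi>)+
    have "(LINT z|circle_measure. of_real (\<phi> z) * h z) =
        (LINT z|circle_measure. of_real (\<phi> z) * h z - cnj z ^ N * poly p z * h z)"
      by (subst Bochner_Integration.integral_diff[OF i]) (simp add: ort)
    also have "cmod \<dots> \<le> (LINT z|circle_measure. e / (H + 1) * cmod (h z))"
    proof (rule Bochner_Integration.integral_norm_bound_integral)
      show "norm (of_real (\<phi> z) * h z - cnj z ^ N * poly p z * h z) \<le> e / (H + 1) * cmod (h z)"
        if "z \<in> space circle_measure" for z
        using mult_right_mono[OF less_imp_le[OF Np[of z]], of "cmod (h z)"] that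
        by (simp add: norm_mult flip: left_diff_distrib)
    qed (use h i in auto)
    also have "\<dots> = e / (H + 1) * H" by (simp add: H_def)
    also have "\<dots> \<le> e" using e H by (simp add: field_simps)
    finally show ?thesis .
  qed
  then show "(LINT z|circle_measure. of_real (\<phi> z) * h z) = 0"
    by (metis field_le_epsilon add_0 norm_le_zero_iff)
qed

section \<open>Fourier coefficients and polynomials\<close>

lemma square_integrable_poly: "square_integrable circle_measure (poly p)"
  by (intro square_integrable_circle continuous_intros)

lemma L2_tendsto_circle_mult:
  assumes "L2_tendsto circle_measure s g" and w: "continuous_on unit_circle w"
  shows "L2_tendsto circle_measure (\<lambda>n z. w z * s n z) (\<lambda>z. w z * g z)"
proof -
  obtain B where "AE z in circle_measure. cmod (w z) \<le> B"
    by (rule continuous_circle_bound[OF w])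
  then show ?thesis
    by (rule L2_tendsto_bounded_mult[OF assms(1) borel_measurable_circle[OF w]])
qed

lemma cnj_power_mult_power_circle:
  assumes "cmod z = 1"
  shows "cnj z ^ N * z ^ j = (if N \<le> j then z ^ (j - N) else cnj z ^ (N - j))"
proof -
  have zz: "cnj z ^ k * z ^ k = 1" for k
    using mult_cnj_circle[OF assms] by (simp add: power_mult_distrib[symmetric] mult.commute)
  show ?thesis
  proof (cases "N \<le> j")
    case True
    then have "z ^ j = z ^ N * z ^ (j - N)" by (simp flip: power_add)
    then show ?thesis using zz[of N] True by (simp flip: mult.assoc)
  next
    case False
    then have "cnj z ^ N = cnj z ^ (N - j) * cnj z ^ j" by (simp flip: power_add)
    then show ?thesis using zz[of j] False by (simp add: mult.assoc)
  qed
qed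

text \<open>Uniqueness of Fourier coefficients, for merely integrable functions: it will be applied
  to \<open>|w V|^2\<close> minus a constant, where \<open>V\<close> is only known to be square
  integrable.\<close>

lemma AE_zero_if_moments_zero:
  fixes h :: "complex \<Rightarrow> complex"
  assumes h: "integrable circle_measure h"
    and pos: "\<And>k. (LINT z|circle_measure. z ^ k * h z) = 0"
    and neg: "\<And>k. (LINT z|circle_measure. cnj z ^ k * h z) = 0"
  shows "AE z in circle_measure. h z = 0"
proof (rule AE_zero_if_integral_trig_poly[OF h])
  fix N p
  have "(LINT z|circle_measure. cnj z ^ N * poly p z * h z) =
      (LINT z|circle_measure. (\<Sum>j\<le>degree p. coeff p j * (cnj z ^ N * z ^ j * h z)))"
    by (simp add: poly_altdef sum_distrib_left sum_distrib_right mult_ac)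
  also have "\<dots> = (\<Sum>j\<le>degree p. (LINT z|circle_measure. coeff p j * (cnj z ^ N * z ^ j * h z)))"
    by (intro Bochner_Integration.integral_sum integrable_mult_right integrable_circle_mult h
        continuous_intros)
  also have "\<dots> = 0"
  proof (rule sum.neutral, rule ballI)
    fix j
    have "(LINT z|circle_measure. cnj z ^ N * z ^ j * h z) =
        (LINT z|circle_measure. (if N \<le> j then z ^ (j - N) else cnj z ^ (N - j)) * h z)"
      by (rule Bochner_Integration.integral_cong) (simp_all add: cnj_power_mult_power_circle)
    then show "(LINT z|circle_measure. coeff p j * (cnj z ^ N * z ^ j * h z)) = 0"
      using pos neg by (cases "N \<le> j") simp_all
  qed
  finally show "(LINT z|circle_measure. cnj z ^ N * poly p z * h z) = 0" .
qed

lemma integral_cnj_power_poly: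
  "(LINT z|circle_measure. cnj z ^ j * poly p z) = coeff p j"
proof -
  have pow: "(LINT z|circle_measure. cnj z ^ j * z ^ i) = (if i = j then 1 else 0)" for i
  proof -
    have "(LINT z|circle_measure. cnj z ^ j * z ^ i) =
        (LINT z|circle_measure. (if j \<le> i then z ^ (i - j) else cnj (z ^ (j - i))))"
      by (rule Bochner_Integration.integral_cong) (simp_all add: cnj_power_mult_power_circle)
    also have "\<dots> = (if i = j then 1 else 0)"
      by (cases "j \<le> i") (auto simp: integral_circle_power simp del: complex_cnj_power)
    finally show ?thesis .
  qed
  have "(LINT z|circle_measure. cnj z ^ j * poly p z) =
      (LINT z|circle_measure. (\<Sum>i\<le>degree p. coeff p i * (cnj z ^ j * z ^ i)))"
    by (simp add: poly_altdef sum_distrib_left mult_ac)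
  also have "\<dots> = (\<Sum>i\<le>degree p. (LINT z|circle_measure. coeff p i * (cnj z ^ j * z ^ i)))"
    by (intro Bochner_Integration.integral_sum circle.integrable_square_integrable square_integrable_circle
        continuous_intros)
  also have "\<dots> = (\<Sum>i\<le>degree p. if i = j then coeff p i else 0)"
    by (intro sum.cong) (simp_all add: pow)
  also have "\<dots> = coeff p j" by (simp add: coeff_eq_0)
  finally show ?thesis .
qed

lemma poly_eq_0_if_AE:
  assumes "AE z in circle_measure. poly p z = 0"
  shows "p = 0"
proof (rule poly_eqI)
  fix j
  have "(LINT z|circle_measure. cnj z ^ j * poly p z) = (LINT z|circle_measure. 0)"
  proof (rule integral_cong_AE)
    show "AE z in circle_measure. cnj z ^ j * poly p z = 0"
      using assms by eventually_elim simp
  qed (auto intro!: borel_measurable_circle continuous_intros)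
  then show "coeff p j = coeff 0 j" by (simp add: integral_cnj_power_poly)
qed

text \<open>Coefficients are continuous in the L2 norm, being integrals against
  \<open>cnj z ^ j\<close>. With only \<open>n + 1\<close> of them, their convergence gives
  pointwise convergence everywhere, and an almost everywhere convergent subsequence identifies the
  limit with \<open>g\<close>.\<close>

lemma L2_tendsto_poly_degree_le:
  assumes lim: "L2_tendsto circle_measure (\<lambda>m. poly (k m)) g" and deg: "\<And>m. degree (k m) \<le> n"
  obtains p where "degree p \<le> n" "AE z in circle_measure. poly p z = g z"
proof -
  define a where "a j = (LINT z|circle_measure. cnj z ^ j * g z)" for j
  define p where "p = (\<Sum>j\<le>n. monom (a j) j)"
  have co: "(\<lambda>m. coeff (k m) j) \<longlonglongrightarrow> a j" for j
  proof -
    have "(\<lambda>m. LINT z|circle_measure. cnj z ^ j * poly (k m) z) \<longlonglongrightarrow> a j"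
      unfolding a_def
      by (intro L2_tendsto_integral_mult L2_tendsto_const lim square_integrable_circle continuous_intros)
    then show ?thesis by (simp add: integral_cnj_power_poly)
  qed
  have pt: "(\<lambda>m. poly (k m) z) \<longlonglongrightarrow> poly p z" for z
  proof -
    have "poly (k m) z = (\<Sum>j\<le>n. coeff (k m) j * z ^ j)" for m
      unfolding poly_altdef using deg[of m]
      by (intro sum.mono_neutral_left) (auto simp: coeff_eq_0)
    moreover have "poly p z = (\<Sum>j\<le>n. a j * z ^ j)"
      by (simp add: p_def poly_sum poly_monom)
    ultimately show ?thesis by (auto intro!: tendsto_intros co)
  qed
  obtain r where r: "strict_mono r" "AE z in circle_measure. (\<lambda>m. poly (k (r m)) z) \<longlonglongrightarrow> g z"
    by (rule L2_tendsto_AE_subseq[OF lim])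
  have "AE z in circle_measure. poly p z = g z"
    using r(2)
  proof eventually_elim
    case (elim z)
    have "(\<lambda>m. poly (k (r m)) z) \<longlonglongrightarrow> poly p z"
      using LIMSEQ_subseq_LIMSEQ[OF pt r(1)] by (simp add: o_def)
    then show ?case using elim LIMSEQ_unique by blast
  qed
  moreover have "degree p \<le> n"
    unfolding p_def by (intro degree_sum_le) (auto intro: order_trans[OF degree_monom_le])
  ultimately show ?thesis by (intro that)
qed

section \<open>Topology and measure of arcs\<close>

lemma circle_diff_open_arc_compact:
  assumes "open_arc A"
  shows "compact (unit_circle - A)"
proof -
  obtain a b where ab: "a < b" "b \<le> a + 2 * pi" and A: "A = cis ` {a<..<b}"
    using assms by (auto simp: open_arc_def)
  \<comment> \<open>The rest of one full turn, end points included; for an arc of length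
    \<open>2 * pi\<close> it is a single point.\<close>
  have "unit_circle - A = cis ` {b..a + 2 * pi}"
  proof
    show "unit_circle - A \<subseteq> cis ` {b..a + 2 * pi}"
    proof
      fix z assume z: "z \<in> unit_circle - A"
      \<comment> \<open>Subtracting \<open>k\<close> turns moves the argument of \<open>z\<close>
        into the half-open interval from \<open>a\<close> to \<open>a + 2 * pi\<close>.\<close>
      define k where "k = \<lfloor>(Arg z - a) / (2 * pi)\<rfloor>"
      define t where "t = Arg z - 2 * pi * of_int k"
      have "cis t = cis (Arg z)"
        unfolding t_def by (simp add: cis_mult[symmetric] cis_divide[symmetric])
      also have "\<dots> = z" using z by (intro cis_Arg[of z, THEN trans]) (auto simp: sgn_div_norm)
      finally have ct: "cis t = z" .
      have "of_int k \<le> (Arg z - a) / (2 * pi)" "(Arg z - a) / (2 * pi) < of_int k + 1"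
        unfolding k_def by linarith+
      then have t: "a \<le> t" "t < a + 2 * pi" by (simp_all add: t_def field_simps)
      show "z \<in> cis ` {b..a + 2 * pi}"
      \<comment> \<open>The left end point of the arc is excluded from \<open>A\<close>, but its
        parameter \<open>a\<close> may lie below \<open>b\<close>; one turn later it is the right
        end of the closed interval.\<close>
      proof (cases "t = a")
        case True
        then have "cis (a + 2 * pi) = z" using ct by (simp add: cis_mult[symmetric])
        then show ?thesis using ab by (intro image_eqI[of _ _ "a + 2 * pi"]) auto
      next
        case False
        then have "b \<le> t" using z t ct unfolding A by (cases "t < b") auto
        then show ?thesis using t ct by (intro image_eqI[of _ _ t]) auto
      qed
    qed
    show "cis ` {b..a + 2 * pi} \<subseteq> unit_circle - A"
    proof
      fix z assume "z \<in> cis ` {b..a + 2 * pi}"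
      then obtain t where t: "b \<le> t" "t \<le> a + 2 * pi" "z = cis t" by auto
      have "cis t \<noteq> cis u" if u: "a < u" "u < b" for u
      proof
        assume "cis t = cis u"
        then have "sin t = sin u \<and> cos t = cos u" by (simp add: complex_eq_iff)
        then obtain n :: int where n: "t = u + 2 * pi * n"
          unfolding sin_cos_eq_iff by blast
        have "0 < 2 * pi * n" "2 * pi * n < 2 * pi * 1" using n t u ab by linarith+
        then have "0 < n" "n < 1" by (simp_all add: zero_less_mult_iff mult_less_cancel_left)
        then show False by simp
      qed
      then have "cis t \<notin> A" unfolding A image_iff by (meson greaterThanLessThan_iff)
      then show "z \<in> unit_circle - A" using t(3) by simp
    qed
  qed
  then show ?thesis
    by (simp add: compact_continuous_image continuous_on_cis)
qed

lemma open_arc_subset_circle: "open_arc A \<Longrightarrow> A \<subseteq> unit_circle"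
  by (auto simp: open_arc_def)

lemma open_arc_measurable:
  assumes "open_arc A"
  shows "A \<in> sets circle_measure"
proof -
  have "unit_circle - A \<in> sets circle_measure"
    using borel_set_circle[of "unit_circle - A"] circle_diff_open_arc_compact[OF assms]
    by (simp add: borel_compact Int_absorb2)
  then have "unit_circle - (unit_circle - A) \<in> sets circle_measure"
    using sets.compl_sets by fastforce
  then show ?thesis using open_arc_subset_circle[OF assms] by (simp add: double_diff)
qed

text \<open>The parameter interval of the arc need not lie in the fundamental interval from 0 to
  \<open>2 * pi\<close>. So its midpoint is reduced modulo \<open>2 * pi\<close>, and a short
  interval to the right of the reduced point is used.\<close>

lemma measure_open_arc_pos:
  assumes "open_arc A"
  shows "0 < measure circle_measure A"
proof -
  let ?U = "uniform_measure lborel {0..<2 * pi}"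
  obtain a b where ab: "a < b" "b \<le> a + 2 * pi" and A: "A = cis ` {a<..<b}"
    using assms by (auto simp: open_arc_def)
  define m where "m = (a + b) / 2"
  define k where "k = \<lfloor>m / (2 * pi)\<rfloor>"
  define t where "t = m - 2 * pi * of_int k"
  \<comment> \<open>The first bound keeps the shifted interval inside the arc, the second keeps it
    inside the fundamental interval; half-openness makes both inequalities strict.\<close>
  define e where "e = min (b - m) (2 * pi - t)"
  have "of_int k \<le> m / (2 * pi)" "m / (2 * pi) < of_int k + 1"
    unfolding k_def by linarith+
  then have t: "0 \<le> t" "t < 2 * pi" by (simp_all add: t_def field_simps)
  have m: "a < m" "m < b" using ab by (auto simp: m_def)
  have e: "0 < e" using m t by (simp add: e_def)
  have sub: "{t..<t + e} \<subseteq> {0..<2 * pi} \<inter> (cis -` A \<inter> space ?U)"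
  proof
    fix s assume s: "s \<in> {t..<t + e}"
    have "cis s = cis (s + 2 * pi * of_int k)" by (simp add: cis_mult[symmetric])
    moreover have "s + 2 * pi * of_int k \<in> {a<..<b}"
      using s m by (auto simp: t_def e_def)
    ultimately have "cis s \<in> A" unfolding A by blast
    moreover have "s < 2 * pi" using s by (auto simp: e_def)
    ultimately show "s \<in> {0..<2 * pi} \<inter> (cis -` A \<inter> space ?U)" using s t by auto
  qed
  have meas: "cis -` A \<inter> space ?U \<in> sets ?U"
  proof (rule measurable_sets[OF cis_measurable_circle])
    show "A \<in> sets (restrict_space borel unit_circle)"
      using open_arc_measurable[OF assms] by (simp add: sets_circle_measure)
  qed
  have "0 < ennreal e" using e by simp
  also have "ennreal e = emeasure lborel {t..<t + e}" using e by simp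
  also have "\<dots> \<le> emeasure lborel ({0..<2 * pi} \<inter> (cis -` A \<inter> space ?U))"
    using meas by (intro emeasure_mono sub) auto
  finally have "0 < emeasure ?U (cis -` A \<inter> space ?U)"
    using meas by (simp add: emeasure_uniform_measure ennreal_zero_less_divide)
  also have "\<dots> = emeasure circle_measure A"
    unfolding circle_measure_def
    using open_arc_measurable[OF assms]
    by (subst emeasure_distr[OF cis_measurable_circle]) (simp_all add: sets_circle_measure)
  finally show ?thesis
    by (simp add: circle.emeasure_eq_measure)
qed

section \<open>An extremal problem of Szego type\<close>

text \<open>This is a multiplier: the weight in the integrals is its squared modulus,
  \<open>s ^ 2\<close> on \<open>K\<close>. In this form the extremal problem is a least norm
  problem for the products \<open>szego_weight K s z * poly p z\<close>.\<close>

definition szego_weight :: "complex set \<Rightarrow> real \<Rightarrow> complex \<Rightarrow> complex" where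
  "szego_weight K s z = (if z \<in> K then of_real s else 1)"

text \<open>By Szego's theorem this is the exponential of the mean of the logarithm of the weight,
  that is, \<open>s\<close> to the power \<open>2 * measure circle_measure K\<close> for positive
  \<open>s\<close>. The proof works with a geometric decay estimate in place of this value.\<close>

definition szego_infimum :: "complex set \<Rightarrow> real \<Rightarrow> real" where
  "szego_infimum K s =
     (INF p\<in>{p. coeff p 0 = 1}. LINT z|circle_measure. (cmod (szego_weight K s z * poly p z))\<^sup>2)"

lemma szego_weight_measurable:
  "K \<in> sets circle_measure \<Longrightarrow> szego_weight K s \<in> borel_measurable circle_measure"
  unfolding szego_weight_def[abs_def] by (intro measurable_If_set) (use sets.Int_space_eq2 in fastforce)+

lemma szego_weight_bound:
  "0 < s \<Longrightarrow> s \<le> 1 \<Longrightarrow> AE z in M. cmod (szego_weight K s z) \<le> 1"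
  by (simp add: szego_weight_def)

lemma szego_infimum_le:
  "coeff p 0 = 1 \<Longrightarrow>
    szego_infimum K s \<le> (LINT z|circle_measure. (cmod (szego_weight K s z * poly p z))\<^sup>2)"
  unfolding szego_infimum_def by (intro cINF_lower bdd_belowI2[where m = 0]) auto

lemma szego_infimum_nonneg: "0 \<le> szego_infimum K s"
  unfolding szego_infimum_def
proof (rule cINF_greatest)
  have "coeff (1 :: complex poly) 0 = 1" by simp
  then show "{p :: complex poly. coeff p 0 = 1} \<noteq> {}" by blast
qed simp

text \<open>The infimum ranges over polynomials only; continuity of the weighted norm admits their
  L2 limits as test functions.\<close>

lemma szego_infimum_le_limit:
  assumes K: "K \<in> sets circle_measure" and s: "0 < s" "s \<le> 1"
    and lim: "L2_tendsto circle_measure (\<lambda>n. poly (p n)) V" and p: "\<And>n. coeff (p n) 0 = 1"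
  shows "szego_infimum K s \<le> (LINT z|circle_measure. (cmod (szego_weight K s z * V z))\<^sup>2)"
proof (rule LIMSEQ_le_const)
  show "(\<lambda>n. LINT z|circle_measure. (cmod (szego_weight K s z * poly (p n) z))\<^sup>2) \<longlonglongrightarrow>
      (LINT z|circle_measure. (cmod (szego_weight K s z * V z))\<^sup>2)"
    by (rule L2_tendsto_norm_sq[OF L2_tendsto_bounded_mult[OF lim szego_weight_measurable[OF K]
            szego_weight_bound[OF s]]])
qed (use szego_infimum_le p in blast)

text \<open>Multiplying by \<open>1 + t * z ^ k\<close> with \<open>k > 0\<close> does not change
  the constant coefficient, so minimality forces the \<open>k\<close>-th moment of
  \<open>|w V|^2\<close> to vanish. Since this function is real, all its nonzero Fourier indices
  disappear, and it equals its mean, the minimum.\<close>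

lemma szego_extremal:
  assumes K: "K \<in> sets circle_measure" and s: "0 < s" "s \<le> 1"
  obtains p V where "L2_tendsto circle_measure (\<lambda>n. poly (p n)) V" "\<forall>n. coeff (p n) 0 = 1"
    "AE z in circle_measure. (cmod (szego_weight K s z * V z))\<^sup>2 = szego_infimum K s"
proof -
  define w where "w = szego_weight K s"
  define c where "c = szego_infimum K s"
  define Q where "Q g = (LINT z|circle_measure. (cmod (w z * g z))\<^sup>2)" for g
  have wm: "w \<in> borel_measurable circle_measure" and wb: "AE z in circle_measure. cmod (w z) \<le> 1"
    using szego_weight_measurable[OF K] szego_weight_bound[OF s] by (auto simp: w_def)
  have sq: "square_integrable circle_measure (\<lambda>z. w z * poly p z)" for p
    by (rule square_integrable_bounded_mult[OF square_integrable_poly wm wb])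
  have low: "c \<le> Q (poly p)" if "coeff p 0 = 1" for p
    using szego_infimum_le[OF that] by (simp add: Q_def c_def w_def)
  have "\<exists>p. coeff p 0 = 1 \<and> Q (poly p) < c + 1 / real (Suc n)" for n
  proof -
    have ne: "{p :: complex poly. coeff p 0 = 1} \<noteq> {}"
      by (rule ex_in_conv[THEN iffD1], rule exI[of _ 1]) simp
    have "(INF p\<in>{p. coeff p 0 = 1}. Q (poly p)) < c + 1 / real (Suc n)"
      by (simp add: Q_def c_def w_def szego_infimum_def)
    then show ?thesis
      using cInf_lessD[of "(\<lambda>p. Q (poly p)) ` {p. coeff p 0 = 1}"] ne by auto
  qed
  then obtain p where p0: "\<And>n. coeff (p n) 0 = 1" and pn: "\<And>n. Q (poly (p n)) < c + 1 / real (Suc n)"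
    by metis
  have diff: "(LINT z|circle_measure. (cmod (poly (p i) z - poly (p j) z))\<^sup>2) \<le>
      (2 / real (Suc i) + 2 / real (Suc j)) / s\<^sup>2" for i j
  proof -
    \<comment> \<open>The midpoint again has constant coefficient 1, so it is a competitor and the
      parallelogram identity makes the minimising sequence Cauchy.\<close>
    have "c \<le> Q (poly (smult (1 / 2) (p i + p j)))" by (rule low) (simp add: p0)
    moreover have "(LINT z|circle_measure. (cmod (w z * poly (p i) z - w z * poly (p j) z))\<^sup>2) =
        2 * Q (poly (p i)) + 2 * Q (poly (p j)) - 4 * Q (poly (smult (1 / 2) (p i + p j)))"
      by (simp add: integral_parallelogram[OF sq sq] Q_def distrib_left add_divide_distrib)
    ultimately have d: "(LINT z|circle_measure. (cmod (w z * poly (p i) z - w z * poly (p j) z))\<^sup>2) \<le>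
        2 / real (Suc i) + 2 / real (Suc j)"
      using pn[of i] pn[of j] by simp
    \<comment> \<open>Since \<open>s <= 1\<close>, the multiplier is at least \<open>s\<close> in
      modulus everywhere, so being Cauchy in the weighted norm implies being Cauchy in L2.\<close>
    have "s\<^sup>2 * (LINT z|circle_measure. (cmod (poly (p i) z - poly (p j) z))\<^sup>2) =
        (LINT z|circle_measure. s\<^sup>2 * (cmod (poly (p i) z - poly (p j) z))\<^sup>2)"
      by simp
    also have "\<dots> \<le> (LINT z|circle_measure. (cmod (w z * poly (p i) z - w z * poly (p j) z))\<^sup>2)"
    proof (rule integral_mono)
      show "integrable circle_measure (\<lambda>z. s\<^sup>2 * (cmod (poly (p i) z - poly (p j) z))\<^sup>2)"
        by (intro integrable_mult_right square_integrable_norm_sq square_integrable_diff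
            square_integrable_poly)
      show "integrable circle_measure (\<lambda>z. (cmod (w z * poly (p i) z - w z * poly (p j) z))\<^sup>2)"
        by (intro square_integrable_norm_sq square_integrable_diff sq)
      fix z
      have "s\<^sup>2 \<le> (cmod (w z))\<^sup>2"
        using s by (auto simp: w_def szego_weight_def power_le_one)
      then show "s\<^sup>2 * (cmod (poly (p i) z - poly (p j) z))\<^sup>2 \<le> (cmod (w z * poly (p i) z - w z * poly (p j) z))\<^sup>2"
        by (simp add: norm_mult power_mult_distrib mult_right_mono flip: right_diff_distrib)
    qed
    finally show ?thesis
      using d s by (simp add: pos_le_divide_eq mult.commute)
  qed
  have "\<exists>N. \<forall>i\<ge>N. \<forall>j\<ge>N. (LINT z|circle_measure. (cmod (poly (p i) z - poly (p j) z))\<^sup>2) < e"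
    if e: "e > 0" for e
  proof -
    obtain N where N: "4 / (s\<^sup>2 * e) < real N" using reals_Archimedean2 by blast
    have "(LINT z|circle_measure. (cmod (poly (p i) z - poly (p j) z))\<^sup>2) < e" if ij: "i \<ge> N" "j \<ge> N" for i j
    proof -
      have "2 / real (Suc i) + 2 / real (Suc j) \<le> 2 / real (Suc N) + 2 / real (Suc N)"
        using ij by (intro add_mono divide_left_mono) auto
      then have "(2 / real (Suc i) + 2 / real (Suc j)) / s\<^sup>2 \<le> 4 / real (Suc N) / s\<^sup>2"
        by (intro divide_right_mono) auto
      also have "\<dots> < e"
      proof -
        have "4 < e * s\<^sup>2 * real N" using N s e by (simp add: field_simps)
        also have "\<dots> \<le> e * s\<^sup>2 * real (Suc N)" using e by (intro mult_left_mono) auto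
        finally show ?thesis using s by (simp add: pos_divide_less_eq mult_ac)
      qed
      finally show ?thesis using diff[of i j] by linarith
    qed
    then show ?thesis by blast
  qed
  then obtain V where V: "L2_tendsto circle_measure (\<lambda>n. poly (p n)) V"
    using circle.L2_complete[of "\<lambda>n. poly (p n)"] square_integrable_poly by metis
  have sqV: "square_integrable circle_measure V" using V by (simp add: L2_tendsto_def)
  have sqwV: "square_integrable circle_measure (\<lambda>z. w z * V z)"
    by (rule square_integrable_bounded_mult[OF sqV wm wb])
  have QV: "Q V = c"
  proof (rule antisym)
    have "(\<lambda>n. Q (poly (p n))) \<longlonglongrightarrow> Q V"
      unfolding Q_def by (rule L2_tendsto_norm_sq[OF L2_tendsto_bounded_mult[OF V wm wb]])
    moreover have "(\<lambda>n. c + 1 / real (Suc n)) \<longlonglongrightarrow> c + 0"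
      by (intro tendsto_intros LIMSEQ_Suc[OF lim_1_over_n])
    ultimately show "Q V \<le> c"
      using LIMSEQ_le[of "\<lambda>n. Q (poly (p n))" "Q V" "\<lambda>n. c + 1 / real (Suc n)" "c + 0"] pn less_imp_le
      by auto
    show "c \<le> Q V"
      using szego_infimum_le_limit[OF K s V p0] by (simp add: Q_def c_def w_def)
  qed
  define r where "r z = (cmod (w z * V z))\<^sup>2" for z
  have ri: "integrable circle_measure r"
    unfolding r_def by (rule square_integrable_norm_sq[OF sqwV])
  have r_int: "(LINT z|circle_measure. r z) = c" using QV by (simp add: Q_def r_def)
  have c0: "0 \<le> c" by (simp add: c_def szego_infimum_nonneg)
  have moment: "(LINT z|circle_measure. z ^ k * of_real (r z)) = 0" if k: "k > 0" for k
  proof -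
    define A where "A = (LINT z|circle_measure. z ^ k * of_real (r z))"
    \<comment> \<open>With \<open>t = - e * cnj A\<close> the change of the quadratic form is
      \<open>e * |A|^2 * (e * c - 2)\<close>, negative unless \<open>A = 0\<close> once
      \<open>e * c < 2\<close>; the added 1 in the denominator allows \<open>c = 0\<close>.\<close>
    define e where "e = 1 / (c + 1)"
    have e: "0 < e" "e * c < 2" using c0 by (auto simp: e_def field_simps)
    define t where "t = - of_real e * cnj A"
    have Ai: "integrable circle_measure (\<lambda>z. z ^ k * of_real (r z) :: complex)"
      by (intro integrable_circle_mult continuous_intros integrable_of_real ri)
    have "c \<le> Q (\<lambda>z. V z + t * z ^ k * V z)"
      unfolding Q_def c_def w_def
    proof (rule szego_infimum_le_limit[OF K s])
      show "L2_tendsto circle_measure (\<lambda>n. poly (p n + smult t (monom 1 k) * p n)) (\<lambda>z. V z + t * z ^ k * V z)"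
        by (rule L2_tendsto_cong[OF L2_tendsto_add[OF V
                L2_tendsto_circle_mult[OF V, of "\<lambda>z. t * z ^ k"]]])
          (simp_all add: poly_monom continuous_intros)
      show "coeff (p n + smult t (monom 1 k) * p n) 0 = 1" for n
        using k by (simp add: p0 coeff_mult_0)
    qed
    also have "\<dots> = (LINT z|circle_measure. r z + 2 * Re (t * (z ^ k * of_real (r z))) + (cmod t)\<^sup>2 * r z)"
      unfolding Q_def
    proof (rule Bochner_Integration.integral_cong[OF refl])
      fix z assume "z \<in> space circle_measure"
      then have z: "cmod z = 1" by simp
      have "w z * (V z + t * z ^ k * V z) = (1 + t * z ^ k) * (w z * V z)" by (simp add: algebra_simps)
      then have "(cmod (w z * (V z + t * z ^ k * V z)))\<^sup>2 = (cmod (1 + t * z ^ k))\<^sup>2 * r z"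
        by (simp only: norm_mult[of "1 + t * z ^ k"] power_mult_distrib r_def)
      also have "(cmod (1 + t * z ^ k))\<^sup>2 = 1 + 2 * Re (t * z ^ k) + (cmod (t * z ^ k))\<^sup>2"
        by (simp only: cmod_power2) (simp add: power2_eq_square algebra_simps)
      also have "cmod (t * z ^ k) = cmod t" using z by (simp add: norm_mult norm_power)
      finally show "(cmod (w z * (V z + t * z ^ k * V z)))\<^sup>2 =
          r z + 2 * Re (t * (z ^ k * of_real (r z))) + (cmod t)\<^sup>2 * r z"
        by (simp add: algebra_simps)
    qed
    also have "\<dots> = c + 2 * Re (t * A) + (cmod t)\<^sup>2 * c"
    proof -
      define R where "R z = Re (t * (z ^ k * of_real (r z)))" for z
      have Ri: "integrable circle_measure R"
        unfolding R_def by (intro integrable_Re integrable_mult_right Ai)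
      have "(LINT z|circle_measure. R z) = Re (LINT z|circle_measure. t * (z ^ k * of_real (r z)))"
        unfolding R_def by (intro integral_Re integrable_mult_right Ai)
      also have "\<dots> = Re (t * A)" by (simp only: integral_mult_right_zero A_def)
      finally show ?thesis
        using ri Ri unfolding R_def[symmetric] by (simp add: r_int)
    qed
    finally have "0 \<le> 2 * Re (t * A) + (cmod t)\<^sup>2 * c" by simp
    moreover have "Re (t * A) = - e * (cmod A)\<^sup>2"
      unfolding cmod_power2 by (simp add: t_def power2_eq_square algebra_simps)
    moreover have "(cmod t)\<^sup>2 = e\<^sup>2 * (cmod A)\<^sup>2"
      by (simp add: t_def norm_mult power_mult_distrib)
    ultimately have "0 \<le> e * (cmod A)\<^sup>2 * (e * c - 2)"
      by (simp add: algebra_simps power2_eq_square)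
    then have "(cmod A)\<^sup>2 \<le> 0"
      using e by (simp add: zero_le_mult_iff mult_le_0_iff)
    then show ?thesis by (simp add: A_def)
  qed
  have hi: "integrable circle_measure (\<lambda>z. complex_of_real (r z - c))"
    using ri by (simp add: integrable_of_real)
  have pos: "(LINT z|circle_measure. z ^ k * complex_of_real (r z - c)) = 0" for k
  proof (cases "k = 0")
    case True
    have "(LINT z|circle_measure. r z - c) = 0"
      using ri r_int by (simp add: circle.prob_space[unfolded space_circle_measure])
    then show ?thesis
      by (simp only: True power_0 mult_1_left integral_complex_of_real of_real_0)
  next
    case False
    have "(LINT z|circle_measure. z ^ k * complex_of_real (r z - c)) =
      (LINT z|circle_measure. z ^ k * of_real (r z) - of_real c * z ^ k)"
      by (rule Bochner_Integration.integral_cong) (auto simp: algebra_simps)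
    also have "\<dots> = (LINT z|circle_measure. z ^ k * of_real (r z)) - (LINT z|circle_measure. of_real c * z ^ k)"
    proof (rule Bochner_Integration.integral_diff)
      show "integrable circle_measure (\<lambda>z. z ^ k * complex_of_real (r z))"
        by (intro integrable_circle_mult continuous_intros integrable_of_real ri)
      show "integrable circle_measure (\<lambda>z. complex_of_real c * z ^ k)"
        by (intro circle.integrable_square_integrable square_integrable_circle continuous_intros)
    qed
    also have "\<dots> = 0" using False by (simp add: moment integral_circle_power)
    finally show ?thesis .
  qed
  have "AE z in circle_measure. complex_of_real (r z - c) = 0"
  \<comment> \<open>As \<open>r\<close> is real, the moments against \<open>cnj z ^ k\<close> are
    conjugates of those already computed.\<close>
  proof (rule AE_zero_if_moments_zero[OF hi pos])
    fix k
    have "(LINT z|circle_measure. cnj z ^ k * complex_of_real (r z - c)) =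
        (LINT z|circle_measure. cnj (z ^ k * complex_of_real (r z - c)))" by simp
    also have "\<dots> = cnj (LINT z|circle_measure. z ^ k * complex_of_real (r z - c))"
      by (rule Bochner_Integration.integral_cnj)
    finally show "(LINT z|circle_measure. cnj z ^ k * complex_of_real (r z - c)) = 0"
      by (simp only: pos complex_cnj_zero)
  qed
  then have "AE z in circle_measure. (cmod (szego_weight K s z * V z))\<^sup>2 = szego_infimum K s"
    unfolding of_real_eq_0_iff by (simp add: r_def w_def c_def)
  with V p0 show ?thesis by (intro that) auto
qed

text \<open>The extremal for \<open>s\<close> serves as test function for \<open>s / 2\<close>. Its
  weighted square is still the constant off \<open>K\<close> and a quarter of it on
  \<open>K\<close>, which explains the factor \<open>3 / 4\<close>.\<close>

lemma szego_infimum_halve: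
  assumes K: "K \<in> sets circle_measure" and s: "0 < s" "s \<le> 1"
  shows "szego_infimum K (s / 2) \<le> (1 - 3 / 4 * measure circle_measure K) * szego_infimum K s"
proof -
  define c where "c = szego_infimum K s"
  obtain p V where V: "L2_tendsto circle_measure (\<lambda>n. poly (p n)) V" and p: "\<forall>n. coeff (p n) 0 = 1"
    and eq: "AE z in circle_measure. (cmod (szego_weight K s z * V z))\<^sup>2 = c"
    by (rule szego_extremal[OF K s, folded c_def])
  have [measurable]: "V \<in> borel_measurable circle_measure"
    using V by (simp add: L2_tendsto_def square_integrable_def)
  note [measurable] = K szego_weight_measurable[OF K]
  have "szego_infimum K (s / 2) \<le> (LINT z|circle_measure. (cmod (szego_weight K (s / 2) z * V z))\<^sup>2)"
    using s by (intro szego_infimum_le_limit[OF K _ _ V p[rule_format]]) auto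
  also have "\<dots> = (LINT z|circle_measure. c - 3 / 4 * c * indicator K z)"
  proof (rule integral_cong_AE)
    show "AE z in circle_measure. (cmod (szego_weight K (s / 2) z * V z))\<^sup>2 = c - 3 / 4 * c * indicator K z"
      using eq
    proof eventually_elim
      case (elim z)
      then show ?case
        by (auto simp: szego_weight_def norm_mult power_mult_distrib power_divide indicator_def)
    qed
  qed measurable
  also have "\<dots> = c - 3 / 4 * c * measure circle_measure K"
  proof -
    have "K \<inter> unit_circle = K" using sets.sets_into_space[OF K] by auto
    then show ?thesis
      using K by (simp add: circle.prob_space[unfolded space_circle_measure] less_top[symmetric])
  qed
  finally show ?thesis by (simp add: c_def algebra_simps)
qed

text \<open>Repeated halving brings the constant below \<open>e ^ 2\<close>. Off \<open>K\<close>
  the multiplier is 1, so \<open>V\<close> is small there; on \<open>K\<close> the multiplier is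
  \<open>s\<close>, and the bound degrades to \<open>e / s\<close>, possibly large but
  finite.\<close>

lemma szego_small:
  assumes K: "K \<in> sets circle_measure" "measure circle_measure K > 0" and e: "0 < e"
  obtains p V B where "L2_tendsto circle_measure (\<lambda>n. poly (p n)) V" "\<forall>n. coeff (p n) 0 = 1"
    "AE z in circle_measure. cmod (V z) \<le> B"
    "AE z in circle_measure. z \<notin> K \<longrightarrow> cmod (V z) \<le> e"
proof -
  define q where "q = 1 - 3 / 4 * measure circle_measure K"
  have "measure circle_measure K \<le> 1" by (rule circle.prob_le_1)
  then have q: "0 < q" "q < 1" using K unfolding q_def by linarith+
  have decay: "szego_infimum K ((1 / 2) ^ j) \<le> q ^ j * szego_infimum K 1" for j
  proof (induction j)
    case (Suc j)
    have "szego_infimum K ((1 / 2) ^ j / 2) \<le> q * szego_infimum K ((1 / 2) ^ j)"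
      unfolding q_def by (intro szego_infimum_halve K) (auto simp: power_le_one)
    also have "\<dots> \<le> q * (q ^ j * szego_infimum K 1)"
      using Suc q by (intro mult_left_mono) auto
    finally show ?case by simp
  qed simp
  have "(\<lambda>j. q ^ j * szego_infimum K 1) \<longlonglongrightarrow> 0 * szego_infimum K 1"
    using q by (intro tendsto_intros LIMSEQ_realpow_zero) auto
  then have "\<forall>\<^sub>F j in sequentially. q ^ j * szego_infimum K 1 < e\<^sup>2"
    using e by (intro order_tendstoD(2)) auto
  then obtain j where j: "q ^ j * szego_infimum K 1 < e\<^sup>2"
    by (metis eventually_sequentially order_refl)
  define s :: real where "s = (1 / 2) ^ j"
  have s: "0 < s" "s \<le> 1" by (auto simp: s_def power_le_one)
  have c: "szego_infimum K s \<le> e\<^sup>2" using decay[of j] j by (simp add: s_def)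
  obtain p V where V: "L2_tendsto circle_measure (\<lambda>n. poly (p n)) V" "\<forall>n. coeff (p n) 0 = 1"
    and eq: "AE z in circle_measure. (cmod (szego_weight K s z * V z))\<^sup>2 = szego_infimum K s"
    by (rule szego_extremal[OF K(1) s])
  have le: "AE z in circle_measure. cmod (szego_weight K s z * V z) \<le> e"
    using eq
  proof eventually_elim
    case (elim z)
    then have "(cmod (szego_weight K s z * V z))\<^sup>2 \<le> e\<^sup>2" using c by linarith
    then show ?case using e by (rule power2_le_imp_le[OF _ less_imp_le])
  qed
  have "AE z in circle_measure. cmod (V z) \<le> e / s"
    using le
  proof eventually_elim
    case (elim z)
    have "cmod (V z) * s \<le> cmod (szego_weight K s z * V z)"
      using s by (auto simp: szego_weight_def norm_mult mult_left_le)
    with elim s show ?case by (simp add: pos_le_divide_eq)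
  qed
  moreover have "AE z in circle_measure. z \<notin> K \<longrightarrow> cmod (V z) \<le> e"
    using le by eventually_elim (auto simp: szego_weight_def)
  ultimately show ?thesis by (rule that[OF V])
qed

section \<open>Bounded analytic functions and the Hardy space\<close>

text \<open>The L2 closure of the polynomials. For it limits and products with bounded factors are
  easily handled, and it lies inside \<open>Hardy2\<close>, which is defined by Fourier
  coefficients.\<close>

definition analytic_L2 :: "(complex \<Rightarrow> complex) \<Rightarrow> bool" where
  "analytic_L2 g \<longleftrightarrow> (\<exists>p. L2_tendsto circle_measure (\<lambda>n. poly (p n)) g)"

lemma analytic_L2_square_integrable: "analytic_L2 g \<Longrightarrow> square_integrable circle_measure g"
  by (auto simp: analytic_L2_def L2_tendsto_def)

lemma analytic_L2_measurable: "analytic_L2 g \<Longrightarrow> g \<in> borel_measurable circle_measure"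
  by (simp add: analytic_L2_square_integrable square_integrable_measurable)

lemma analytic_L2_poly: "analytic_L2 (poly p)"
  unfolding analytic_L2_def using L2_tendsto_const[OF square_integrable_poly] by (intro exI[of _ "\<lambda>_. p"])

text \<open>Diagonal choice: the \<open>n\<close>-th term is replaced by a polynomial at squared
  distance below \<open>1 / Suc n\<close>.\<close>

lemma analytic_L2_closed:
  assumes lim: "L2_tendsto circle_measure s g" and s: "\<And>n. analytic_L2 (s n)"
  shows "analytic_L2 g"
proof -
  have "\<exists>p. (LINT z|circle_measure. (cmod (poly p z - s n z))\<^sup>2) < 1 / real (Suc n)" for n
  proof -
    obtain p where p: "(\<lambda>m. LINT z|circle_measure. (cmod (poly (p m) z - s n z))\<^sup>2) \<longlonglongrightarrow> 0"
      using s[of n] by (auto simp: analytic_L2_def L2_tendsto_def)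
    have "\<forall>\<^sub>F m in sequentially. (LINT z|circle_measure. (cmod (poly (p m) z - s n z))\<^sup>2) < 1 / real (Suc n)"
      by (rule order_tendstoD(2)[OF p]) simp
    then show ?thesis by (auto simp: eventually_sequentially)
  qed
  then obtain p where p: "\<And>n. (LINT z|circle_measure. (cmod (poly (p n) z - s n z))\<^sup>2) < 1 / real (Suc n)"
    by metis
  have sq: "square_integrable circle_measure (\<lambda>z. poly (p n) z - s n z)" for n
    by (intro square_integrable_diff square_integrable_poly analytic_L2_square_integrable s)
  have "L2_tendsto circle_measure (\<lambda>n z. poly (p n) z - s n z) (\<lambda>_. 0)"
    unfolding L2_tendsto_def
  proof (intro conjI allI sq)
    show "square_integrable circle_measure (\<lambda>_. 0)" by (simp add: square_integrable_def)
    have "(\<lambda>n. LINT z|circle_measure. (cmod (poly (p n) z - s n z))\<^sup>2) \<longlonglongrightarrow> 0"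
      by (rule tendsto_sandwich[OF _ always_eventually[OF allI[OF less_imp_le[OF p]]] tendsto_const
            LIMSEQ_Suc[OF lim_1_over_n]]) simp
    then show "(\<lambda>n. LINT z|circle_measure. (cmod (poly (p n) z - s n z - 0))\<^sup>2) \<longlonglongrightarrow> 0" by simp
  qed
  from L2_tendsto_add[OF this lim] show ?thesis
    by (auto simp: analytic_L2_def)
qed

lemma analytic_L2_poly_mult:
  assumes "analytic_L2 g"
  shows "analytic_L2 (\<lambda>z. poly q z * g z)"
proof -
  obtain p where p: "L2_tendsto circle_measure (\<lambda>n. poly (p n)) g"
    using assms by (auto simp: analytic_L2_def)
  have "L2_tendsto circle_measure (\<lambda>n. poly (q * p n)) (\<lambda>z. poly q z * g z)"
    by (rule L2_tendsto_cong[OF L2_tendsto_circle_mult[OF p, of "poly q"]])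
      (simp_all add: continuous_intros)
  then show ?thesis unfolding analytic_L2_def by (intro exI)
qed

text \<open>Only \<open>v\<close> is approximated by polynomials; \<open>u\<close> stays fixed, and
  its bound makes multiplication by it continuous in L2.\<close>

lemma analytic_L2_mult:
  assumes u: "analytic_L2 u" "AE z in circle_measure. cmod (u z) \<le> B" and v: "analytic_L2 v"
  shows "analytic_L2 (\<lambda>z. u z * v z)"
proof -
  obtain p where p: "L2_tendsto circle_measure (\<lambda>n. poly (p n)) v"
    using v by (auto simp: analytic_L2_def)
  have "analytic_L2 (\<lambda>z. u z * poly (p n) z)" for n
    using analytic_L2_poly_mult[OF u(1)] by (simp add: mult.commute)
  then show ?thesis
    by (rule analytic_L2_closed[OF L2_tendsto_bounded_mult[OF p analytic_L2_measurable[OF u(1)] u(2)]])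
qed

lemma analytic_L2_power:
  assumes u: "analytic_L2 u" "AE z in circle_measure. cmod (u z) \<le> B"
  shows "analytic_L2 (\<lambda>z. u z ^ N)"
proof (induction N)
  case 0
  have "poly (1 :: complex poly) = (\<lambda>z. z ^ 0)" by (simp add: fun_eq_iff)
  then show ?case using analytic_L2_poly[of 1] by simp
next
  case (Suc N)
  then show ?case using analytic_L2_mult[OF u] by simp
qed

text \<open>The normalisation \<open>coeff (p n) 0 = 1\<close> makes \<open>1 - p n\<close>
  divisible by the variable, so \<open>(1 - V) / z\<close> is again a limit of polynomials. On the
  circle it differs from \<open>cnj z\<close> by exactly \<open>|V|\<close> in modulus.\<close>

lemma analytic_L2_cnj_approximation:
  assumes K: "K \<in> sets circle_measure" "measure circle_measure K > 0" and e: "0 < e"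
  obtains u B where "analytic_L2 u" "AE z in circle_measure. cmod (u z) \<le> B"
    "AE z in circle_measure. z \<notin> K \<longrightarrow> cmod (u z - cnj z) \<le> e"
proof -
  obtain p V B where V: "L2_tendsto circle_measure (\<lambda>n. poly (p n)) V" and p: "\<forall>n. coeff (p n) 0 = 1"
    and B: "AE z in circle_measure. cmod (V z) \<le> B"
    and small: "AE z in circle_measure. z \<notin> K \<longrightarrow> cmod (V z) \<le> e"
    by (rule szego_small[OF K e])
  define u where "u z = cnj z * (1 - V z)" for z
  have "\<exists>q. \<forall>z. 1 - poly (p n) z = z * poly q z" for n
  proof -
    obtain a q where q: "p n = pCons a q" by (cases "p n")
    have "a = 1" using p[rule_format, of n] by (simp add: q)
    then have "1 - poly (p n) z = z * poly (- q) z" for z by (simp add: q)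
    then show ?thesis by blast
  qed
  then obtain q where q: "\<And>n z. 1 - poly (p n) z = z * poly (q n) z" by metis
  have "L2_tendsto circle_measure (\<lambda>n z. cnj z * (1 - poly (p n) z)) u"
    unfolding u_def
    by (intro L2_tendsto_circle_mult L2_tendsto_diff L2_tendsto_const V square_integrable_circle continuous_intros)
  then have "L2_tendsto circle_measure (\<lambda>n. poly (q n)) u"
  proof (rule L2_tendsto_cong)
    fix n z assume "z \<in> space circle_measure"
    then have "z * cnj z = 1" by (simp add: mult_cnj_circle)
    then show "poly (q n) z = cnj z * (1 - poly (p n) z)"
      unfolding q by (simp add: mult.commute flip: mult.assoc)
  qed simp
  then have "analytic_L2 u" by (auto simp: analytic_L2_def)
  moreover have "AE z in circle_measure. cmod (u z) \<le> 1 + B"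
    using B AE_circle
  proof eventually_elim
    case (elim z)
    then have "cmod (1 - V z) \<le> 1 + B" using norm_triangle_ineq4[of 1 "V z"] by simp
    then show ?case using elim by (simp add: u_def norm_mult)
  qed
  moreover have "AE z in circle_measure. z \<notin> K \<longrightarrow> cmod (u z - cnj z) \<le> e"
    using small AE_circle
  proof eventually_elim
    case (elim z)
    have "u z - cnj z = - (cnj z * V z)" by (simp add: u_def algebra_simps)
    then have "cmod (u z - cnj z) = cmod (V z)" using elim by (simp add: norm_mult)
    then show ?case using elim by simp
  qed
  ultimately show ?thesis by (rule that)
qed

text \<open>The radius 2 suits functions within distance 1 of a unimodular one. Scaling by 2 reduces
  the estimate to the unit disk.\<close>

lemma norm_power_diff_le:
  fixes a b :: complex
  assumes "cmod a \<le> 2" "cmod b \<le> 2"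
  shows "cmod (a ^ N - b ^ N) \<le> real N * 2 ^ N * cmod (a - b)"
proof -
  have "cmod ((a / 2) ^ N - (b / 2) ^ N) \<le> real N * cmod (a / 2 - b / 2)"
    using assms by (intro norm_power_diff) (simp_all add: norm_divide)
  then have "cmod (a ^ N - b ^ N) / 2 ^ N \<le> real N * (cmod (a - b) / 2)"
    by (simp add: power_divide norm_divide norm_power flip: diff_divide_distrib)
  also have "\<dots> \<le> real N * cmod (a - b)" by (intro mult_left_mono) auto
  finally show ?thesis by (simp add: pos_divide_le_eq mult_ac)
qed

lemma analytic_L2_trig_approximation:
  assumes K: "K \<in> sets circle_measure" "measure circle_measure K > 0" and e: "0 < e"
  obtains v B where "analytic_L2 v" "AE z in circle_measure. cmod (v z) \<le> B"
    "AE z in circle_measure. z \<notin> K \<longrightarrow> cmod (v z - cnj z ^ N * poly p z) \<le> e"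
proof -
  obtain P where P: "AE z in circle_measure. cmod (poly p z) \<le> P"
    by (rule continuous_circle_bound[of "poly p"]) (auto intro: continuous_intros)
  define P' where "P' = max P 1"
  \<comment> \<open>The Lipschitz constant of the \<open>N\<close>-th power on the disk of radius 2,
    times a bound for \<open>p\<close>. The added 1 keeps \<open>M\<close> positive when
    \<open>N = 0\<close>.\<close>
  define M where "M = real N * 2 ^ N * P' + 1"
  \<comment> \<open>The bound 1 guarantees \<open>cmod (u z) <= 2\<close> off \<open>K\<close>; the
    other bound gives the final error \<open>e\<close>.\<close>
  define d where "d = min 1 (e / M)"
  have P': "1 \<le> P'" by (simp add: P'_def)
  then have M: "0 < M" by (simp add: M_def add_nonneg_pos)
  have d: "0 < d" "d \<le> 1" "M * d \<le> e" using M e by (auto simp: d_def min_def field_simps)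
  obtain u B where u: "analytic_L2 u" "AE z in circle_measure. cmod (u z) \<le> B"
    and small: "AE z in circle_measure. z \<notin> K \<longrightarrow> cmod (u z - cnj z) \<le> d"
    by (rule analytic_L2_cnj_approximation[OF K d(1)])
  define v where "v z = u z ^ N * poly p z" for z
  have "analytic_L2 v"
    unfolding v_def using analytic_L2_poly_mult[OF analytic_L2_power[OF u]] by (simp add: mult.commute)
  moreover have "AE z in circle_measure. cmod (v z) \<le> B ^ N * P'"
    using u(2) P
  proof eventually_elim
    case (elim z)
    then show ?case unfolding v_def norm_mult norm_power
      by (intro mult_mono power_mono) (auto simp: P'_def intro: zero_le_power order_trans[OF norm_ge_zero])
  qed
  moreover have "AE z in circle_measure. z \<notin> K \<longrightarrow> cmod (v z - cnj z ^ N * poly p z) \<le> e"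
    using small P AE_circle
  proof eventually_elim
    case (elim z)
    show ?case
    proof
      assume "z \<notin> K"
      with elim have ud: "cmod (u z - cnj z) \<le> d" by simp
      have "cmod (u z) \<le> cmod (u z - cnj z) + cmod (cnj z)"
        using norm_triangle_ineq[of "u z - cnj z" "cnj z"] by simp
      then have u2: "cmod (u z) \<le> 2" using ud d elim by simp
      have "cmod (u z ^ N - cnj z ^ N) \<le> real N * 2 ^ N * cmod (u z - cnj z)"
        by (rule norm_power_diff_le[OF u2]) (use elim in simp)
      also have "\<dots> \<le> real N * 2 ^ N * d" using ud by (intro mult_left_mono) auto
      finally have "cmod (u z ^ N - cnj z ^ N) * cmod (poly p z) \<le> real N * 2 ^ N * d * P'"
        using elim P' d by (intro mult_mono) (auto simp: P'_def)
      also have "\<dots> \<le> M * d" using d by (simp add: M_def algebra_simps)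
      finally show "cmod (v z - cnj z ^ N * poly p z) \<le> e"
        using d(3) by (simp add: v_def norm_mult flip: left_diff_distrib)
    qed
  qed
  ultimately show ?thesis by (rule that)
qed

section \<open>The Hardy space described by its moments\<close>

lemma L2_on_circle_iff: "g \<in> L2_on unit_circle \<longleftrightarrow> square_integrable circle_measure g"
proof -
  have "set_borel_measurable circle_measure unit_circle g \<longleftrightarrow> g \<in> borel_measurable circle_measure"
    unfolding set_borel_measurable_def by (rule measurable_cong) simp
  moreover have "set_integrable circle_measure unit_circle (\<lambda>z. (cmod (g z))\<^sup>2) \<longleftrightarrow>
      integrable circle_measure (\<lambda>z. (cmod (g z))\<^sup>2)"
    unfolding set_integrable_def by (rule Bochner_Integration.integrable_cong) simp_all
  ultimately show ?thesis by (simp add: L2_on_def square_integrable_def)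
qed

text \<open>The coefficient of index \<open>-k\<close> is the integral of
  \<open>z ^ k * g z\<close>, so in the bilinear pairing, without conjugation, \<open>Hardy2\<close>
  is the annihilator of the positive powers.\<close>

lemma Hardy2_iff:
  "g \<in> Hardy2 \<longleftrightarrow> square_integrable circle_measure g \<and>
     (\<forall>k>0. (LINT z|circle_measure. z ^ k * g z) = 0)"
proof -
  have "(\<forall>k<0. fourier_coeff g k = 0) \<longleftrightarrow> (\<forall>k>0. (LINT z|circle_measure. z ^ k * g z) = 0)"
  proof (intro iffI allI impI)
    fix k :: nat assume "\<forall>k<0. fourier_coeff g k = 0" "k > 0"
    then have "fourier_coeff g (- int k) = 0" by simp
    then show "(LINT z|circle_measure. z ^ k * g z) = 0" by (simp add: fourier_coeff_def mult.commute)
  next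
    fix k :: int assume *: "\<forall>k>0. (LINT z|circle_measure. z ^ k * g z) = 0" and k: "k < 0"
    have "- k = int (nat (- k))" using k by simp
    then have "z powi (- k) = z ^ nat (- k)" for z :: complex by (metis power_int_of_nat)
    then show "fourier_coeff g k = 0"
      using *[rule_format, of "nat (- k)"] k by (simp add: fourier_coeff_def mult.commute)
  qed
  then show ?thesis by (simp add: Hardy2_def L2_on_circle_iff)
qed

lemma Hardy2_closed:
  assumes lim: "L2_tendsto circle_measure s g" and s: "\<And>n. s n \<in> Hardy2"
  shows "g \<in> Hardy2"
  unfolding Hardy2_iff
proof (intro conjI allI impI)
  show "square_integrable circle_measure g" using lim by (simp add: L2_tendsto_def)
  fix k :: nat assume k: "k > 0"
  have "square_integrable circle_measure (\<lambda>z. z ^ k)"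
    by (intro square_integrable_circle continuous_intros)
  from L2_tendsto_integral_mult[OF L2_tendsto_const[OF this] lim]
  show "(LINT z|circle_measure. z ^ k * g z) = 0"
    using s k by (simp add: Hardy2_iff LIMSEQ_const_iff)
qed

lemma poly_in_Hardy2: "poly p \<in> Hardy2"
  unfolding Hardy2_iff
proof (intro conjI allI impI square_integrable_poly)
  fix k :: nat assume "k > 0"
  then show "(LINT z|circle_measure. z ^ k * poly p z) = 0"
    using integral_circle_poly[of "monom 1 k * p"] by (simp add: poly_monom coeff_mult_0)
qed

lemma analytic_L2_in_Hardy2: "analytic_L2 g \<Longrightarrow> g \<in> Hardy2"
  unfolding analytic_L2_def using Hardy2_closed poly_in_Hardy2 by blast

text \<open>\<open>z * v\<close> is a limit of polynomials without constant term. The factor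
  \<open>z\<close> is essential: the coefficient of index 0 of \<open>g\<close> is free.\<close>

lemma Hardy2_mult_orthogonal:
  assumes g: "g \<in> Hardy2" and v: "analytic_L2 v"
  shows "(LINT z|circle_measure. (z * v z) * g z) = 0"
proof -
  obtain p where p: "L2_tendsto circle_measure (\<lambda>n. poly (p n)) v"
    using v by (auto simp: analytic_L2_def)
  have sqg: "square_integrable circle_measure g" using g by (simp add: Hardy2_iff)
  have "(LINT z|circle_measure. (z * poly (p n) z) * g z) = 0" for n
  proof -
    have "(LINT z|circle_measure. (z * poly (p n) z) * g z) =
        (LINT z|circle_measure. (\<Sum>j\<le>degree (p n). coeff (p n) j * (z ^ Suc j * g z)))"
      by (simp add: poly_altdef sum_distrib_left sum_distrib_right mult_ac)
    also have "\<dots> = (\<Sum>j\<le>degree (p n). (LINT z|circle_measure. coeff (p n) j * (z ^ Suc j * g z)))"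
      by (intro Bochner_Integration.integral_sum integrable_mult_right integrable_circle_mult
          circle.integrable_square_integrable sqg continuous_intros)
    also have "\<dots> = 0"
      using g by (intro sum.neutral) (simp add: Hardy2_iff del: power_Suc)
    finally show ?thesis .
  qed
  moreover have "(\<lambda>n. LINT z|circle_measure. (z * poly (p n) z) * g z) \<longlonglongrightarrow> (LINT z|circle_measure. (z * v z) * g z)"
    by (intro L2_tendsto_integral_mult L2_tendsto_const sqg L2_tendsto_circle_mult p continuous_intros)
  ultimately show ?thesis by (simp add: LIMSEQ_const_iff)
qed

lemma Hardy2_linear_combination:
  assumes "g \<in> Hardy2" "h \<in> Hardy2"
  shows "(\<lambda>z. a * g z + b * h z) \<in> Hardy2"
  unfolding Hardy2_iff
proof (intro conjI allI impI)
  have sq: "square_integrable circle_measure g" "square_integrable circle_measure h"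
    using assms by (auto simp: Hardy2_iff)
  show "square_integrable circle_measure (\<lambda>z. a * g z + b * h z)"
    by (intro square_integrable_add square_integrable_cmult sq)
  fix k :: nat assume k: "k > 0"
  have i: "integrable circle_measure (\<lambda>z. z ^ k * g z)" "integrable circle_measure (\<lambda>z. z ^ k * h z)"
    by (intro integrable_circle_mult circle.integrable_square_integrable sq continuous_intros)+
  have "(LINT z|circle_measure. z ^ k * (a * g z + b * h z)) =
      (LINT z|circle_measure. a * (z ^ k * g z) + b * (z ^ k * h z))"
    by (rule Bochner_Integration.integral_cong) (auto simp: algebra_simps)
  also have "\<dots> = a * (LINT z|circle_measure. z ^ k * g z) + b * (LINT z|circle_measure. z ^ k * h z)"
    using i by simp
  finally show "(LINT z|circle_measure. z ^ k * (a * g z + b * h z)) = 0"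
    using assms k by (simp add: Hardy2_iff)
qed

text \<open>\<open>g\<close> annihilates every \<open>z * v\<close>. Off \<open>K\<close> such
  products are uniformly close to any given trigonometric polynomial, and on \<open>K\<close> their
  size is immaterial because \<open>g\<close> is 0 there. Hence \<open>g\<close> annihilates all
  trigonometric polynomials.\<close>

lemma Hardy2_unique:
  assumes g: "g \<in> Hardy2" and K: "K \<in> sets circle_measure" "measure circle_measure K > 0"
    and zero: "AE z in circle_measure. z \<in> K \<longrightarrow> g z = 0"
  shows "AE z in circle_measure. g z = 0"
proof (rule AE_zero_if_integral_trig_poly)
  have sqg: "square_integrable circle_measure g" using g by (simp add: Hardy2_iff)
  show ig: "integrable circle_measure g" by (rule circle.integrable_square_integrable[OF sqg])
  fix N p
  define G where "G = (LINT z|circle_measure. cmod (g z))"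
  have G: "0 \<le> G" by (simp add: G_def)
  have "cmod (LINT z|circle_measure. cnj z ^ N * poly p z * g z) \<le> e" if e: "e > 0" for e
  proof -
    have pos: "0 < e / (G + 1)" using e G by simp
    \<comment> \<open>\<open>Suc N\<close> instead of \<open>N\<close> compensates for the factor
      \<open>z\<close> in the orthogonality relation.\<close>
    obtain v B where v: "analytic_L2 v" "AE z in circle_measure. cmod (v z) \<le> B"
      and app: "AE z in circle_measure. z \<notin> K \<longrightarrow> cmod (v z - cnj z ^ Suc N * poly p z) \<le> e / (G + 1)"
      by (rule analytic_L2_trig_approximation[OF K pos])
    have i: "integrable circle_measure (\<lambda>z. cnj z ^ N * poly p z * g z)"
      by (intro integrable_circle_mult ig continuous_intros)
    have iv: "integrable circle_measure (\<lambda>z. z * v z * g z)"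
      using integrable_circle_mult[OF _ integrable_mult_square_integrable[OF analytic_L2_square_integrable[OF v(1)] sqg],
          of "\<lambda>z. z"]
      by (simp add: mult.assoc continuous_intros)
    have "(LINT z|circle_measure. cnj z ^ N * poly p z * g z) =
        (LINT z|circle_measure. cnj z ^ N * poly p z * g z - z * v z * g z)"
      by (subst Bochner_Integration.integral_diff[OF i iv]) (simp add: Hardy2_mult_orthogonal[OF g v(1)])
    also have "cmod \<dots> \<le> (LINT z|circle_measure. e / (G + 1) * cmod (g z))"
    proof (rule order_trans[OF integral_norm_bound integral_mono_AE])
      show "integrable circle_measure (\<lambda>z. norm (cnj z ^ N * poly p z * g z - z * v z * g z))"
        using i iv by simp
      show "integrable circle_measure (\<lambda>z. e / (G + 1) * cmod (g z))"
        using ig by simp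
      show "AE z in circle_measure. norm (cnj z ^ N * poly p z * g z - z * v z * g z) \<le> e / (G + 1) * cmod (g z)"
        using app zero AE_circle
      proof eventually_elim
        case (elim z)
        show ?case
        proof (cases "z \<in> K")
          case True
          then show ?thesis using elim by simp
        next
          case False
          have "z * cnj z = 1" using elim by (simp add: mult_cnj_circle)
          then have "cnj z ^ N * poly p z = z * (cnj z ^ Suc N * poly p z)"
            by (simp flip: mult.assoc)
          then have "cnj z ^ N * poly p z * g z - z * v z * g z =
              - (z * (v z - cnj z ^ Suc N * poly p z) * g z)"
            by (simp only:) (simp add: algebra_simps)
          then have "norm (cnj z ^ N * poly p z * g z - z * v z * g z) =
              cmod (v z - cnj z ^ Suc N * poly p z) * cmod (g z)"
            using elim by (simp only: norm_minus_cancel norm_mult mult_1_left)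
          also have "\<dots> \<le> e / (G + 1) * cmod (g z)"
            using elim False by (intro mult_right_mono) auto
          finally show ?thesis .
        qed
      qed
    qed
    also have "\<dots> = e / (G + 1) * G" by (simp add: G_def)
    also have "\<dots> \<le> e" using e G by (simp add: field_simps)
    finally show ?thesis .
  qed
  then have "cmod (LINT z|circle_measure. cnj z ^ N * poly p z * g z) \<le> 0"
    by (rule field_le_epsilon) (simp only: add_0)
  then show "(LINT z|circle_measure. cnj z ^ N * poly p z * g z) = 0"
    by (simp only: norm_le_zero_iff)
qed

section \<open>Extremality\<close>

text \<open>A scaling argument. Let \<open>\<phi>\<close> be continuous and zero on
  \<open>J\<close>. For every complex \<open>\<tau>\<close>, however large, some analytic
  \<open>v\<close> is within 1 of \<open>\<tau> * \<phi>\<close> off \<open>K\<close>, hence bounded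
  by 1 on \<open>J - K\<close> and admissible. The error in the pairing is at most the integral of
  \<open>|\<psi>|\<close>, whatever \<open>\<tau>\<close> is. So the real part of
  \<open>\<tau> * A\<close> is bounded above for all \<open>\<tau>\<close>, and
  \<open>A = 0\<close>.\<close>

lemma orthogonal_to_admissible_imp_zero:
  assumes J: "closed J" and K: "K \<in> sets circle_measure" "measure circle_measure K > 0" "K \<subseteq> J"
    and \<psi>: "square_integrable circle_measure \<psi>" "\<And>z. z \<in> J \<Longrightarrow> \<psi> z = 0"
    and bound: "\<And>v B. analytic_L2 v \<Longrightarrow> AE z in circle_measure. cmod (v z) \<le> B \<Longrightarrow>
      AE z in circle_measure. z \<in> J - K \<longrightarrow> cmod (v z) \<le> 1 \<Longrightarrow>
      Re (LINT z|circle_measure. cnj (\<psi> z) * v z) \<le> c"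
  shows "AE z in circle_measure. \<psi> z = 0"
proof -
  have \<psi>': "square_integrable circle_measure (\<lambda>z. cnj (\<psi> z))"
    by (rule square_integrable_cnj[OF \<psi>(1)])
  have i\<psi>: "integrable circle_measure (\<lambda>z. cnj (\<psi> z))"
    by (rule circle.integrable_square_integrable[OF \<psi>'])
  define G where "G = (LINT z|circle_measure. cmod (\<psi> z))"
  have orth: "(LINT z|circle_measure. of_real (\<phi> z) * cnj (\<psi> z)) = 0"
    if cont: "continuous_on UNIV \<phi>" and zero: "\<And>z. z \<in> J \<Longrightarrow> \<phi> z = 0" for \<phi> :: "complex \<Rightarrow> real"
  proof -
    define A where "A = (LINT z|circle_measure. of_real (\<phi> z) * cnj (\<psi> z))"
    have cont': "continuous_on unit_circle \<phi>" using cont by (rule continuous_on_subset) simp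
    have i\<phi>: "integrable circle_measure (\<lambda>z. of_real (\<phi> z) * cnj (\<psi> z))"
      by (intro integrable_circle_mult i\<psi> continuous_intros cont')
    have est: "Re (\<tau> * A) \<le> c + G" for \<tau>
    proof -
      \<comment> \<open>The error 1 is split in half: the trigonometric approximation of
        \<open>\<phi>\<close> costs at most \<open>1 / 2\<close> after multiplication by
        \<open>\<tau>\<close>, and the analytic approximation costs the other
        \<open>1 / 2\<close>.\<close>
      define d where "d = cmod \<tau> + 1"
      have d: "0 < d" "cmod \<tau> \<le> d" by (simp_all add: d_def add_nonneg_pos)
      then have p: "0 < 1 / (2 * d)" by simp
      obtain N p where Np: "\<And>z. cmod z = 1 \<Longrightarrow>
          cmod (of_real (\<phi> z) - cnj z ^ N * poly p z) < 1 / (2 * d)"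
        by (rule trig_poly_approximation[OF cont' p]) blast
      have half: "0 < (1 / 2 :: real)" by simp
      obtain v B where v: "analytic_L2 v" "AE z in circle_measure. cmod (v z) \<le> B"
        and app: "AE z in circle_measure. z \<notin> K \<longrightarrow> cmod (v z - cnj z ^ N * poly (smult \<tau> p) z) \<le> 1 / 2"
        by (rule analytic_L2_trig_approximation[OF K(1,2) half, where N = N and p = "smult \<tau> p"])
      have close: "AE z in circle_measure. z \<notin> K \<longrightarrow> cmod (v z - \<tau> * of_real (\<phi> z)) \<le> 1"
        using app AE_circle
      proof eventually_elim
        case (elim z)
        show ?case
        proof
          assume z: "z \<notin> K"
          have "cmod (\<tau> * (of_real (\<phi> z) - cnj z ^ N * poly p z)) \<le> cmod \<tau> * (1 / (2 * d))"
            unfolding norm_mult using Np[of z] elim by (intro mult_left_mono) auto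
          also have "\<dots> \<le> 1 / 2" using d by (simp add: field_simps)
          finally have "cmod (\<tau> * (of_real (\<phi> z) - cnj z ^ N * poly p z)) \<le> 1 / 2" .
          moreover have "v z - \<tau> * of_real (\<phi> z) = (v z - cnj z ^ N * poly (smult \<tau> p) z) -
              \<tau> * (of_real (\<phi> z) - cnj z ^ N * poly p z)"
            by (simp add: algebra_simps)
          moreover have "cmod (v z - cnj z ^ N * poly (smult \<tau> p) z) \<le> 1 / 2" using elim z by blast
          ultimately show "cmod (v z - \<tau> * of_real (\<phi> z)) \<le> 1"
            by (smt (verit) norm_triangle_ineq4 field_sum_of_halves)
        qed
      qed
      have "AE z in circle_measure. z \<in> J - K \<longrightarrow> cmod (v z) \<le> 1"
        using close by eventually_elim (auto simp: zero)
      then have le: "Re (LINT z|circle_measure. cnj (\<psi> z) * v z) \<le> c"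
        by (rule bound[OF v])
      have iv: "integrable circle_measure (\<lambda>z. cnj (\<psi> z) * v z)"
        by (rule integrable_mult_square_integrable[OF \<psi>' analytic_L2_square_integrable[OF v(1)]])
      have "\<tau> * A - (LINT z|circle_measure. cnj (\<psi> z) * v z) =
          (LINT z|circle_measure. \<tau> * (of_real (\<phi> z) * cnj (\<psi> z)) - cnj (\<psi> z) * v z)"
        using i\<phi> iv by (simp add: A_def)
      also have "cmod \<dots> \<le> (LINT z|circle_measure. cmod (\<psi> z))"
      proof (rule order_trans[OF integral_norm_bound integral_mono_AE])
        show "integrable circle_measure (\<lambda>z. norm (\<tau> * (of_real (\<phi> z) * cnj (\<psi> z)) - cnj (\<psi> z) * v z))"
          using i\<phi> iv by (intro integrable_norm Bochner_Integration.integrable_diff integrable_mult_right)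
        show "integrable circle_measure (\<lambda>z. cmod (\<psi> z))"
          using circle.integrable_square_integrable[OF \<psi>(1)] by simp
        show "AE z in circle_measure. norm (\<tau> * (of_real (\<phi> z) * cnj (\<psi> z)) - cnj (\<psi> z) * v z) \<le> cmod (\<psi> z)"
          using close
        proof eventually_elim
          case (elim z)
          have "\<tau> * (of_real (\<phi> z) * cnj (\<psi> z)) - cnj (\<psi> z) * v z = - ((v z - \<tau> * of_real (\<phi> z)) * cnj (\<psi> z))"
            by (simp add: algebra_simps)
          then have "norm (\<tau> * (of_real (\<phi> z) * cnj (\<psi> z)) - cnj (\<psi> z) * v z) =
              cmod (v z - \<tau> * of_real (\<phi> z)) * cmod (\<psi> z)"
            by (simp only: norm_minus_cancel norm_mult complex_mod_cnj)
          also have "\<dots> \<le> cmod (\<psi> z)"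
          proof (cases "z \<in> J")
            case True
            then show ?thesis using \<psi>(2) by simp
          next
            case False
            then have "z \<notin> K" using K(3) by blast
            then show ?thesis using elim by (intro mult_left_le_one_le) auto
          qed
          finally show ?case .
        qed
      qed
      finally have "Re (\<tau> * A - (LINT z|circle_measure. cnj (\<psi> z) * v z)) \<le> G"
        unfolding G_def using complex_Re_le_cmod order_trans by blast
      then show ?thesis using le by simp
    qed
    have "A = 0"
    proof (rule ccontr)
      assume "A \<noteq> 0"
      then have pos: "0 < (cmod A)\<^sup>2" by simp
      \<comment> \<open>Makes \<open>Re (t * cnj A * A)\<close> equal to \<open>|c + G| + 1\<close>,
        beyond the uniform bound.\<close>
      define t where "t = (\<bar>c + G\<bar> + 1) / (cmod A)\<^sup>2"
      have "of_real t * cnj A * A = complex_of_real (t * (cmod A)\<^sup>2)"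
        by (simp only: of_real_mult complex_norm_square mult.assoc mult.commute[of "cnj A"])
      then have "Re (of_real t * cnj A * A) = t * (cmod A)\<^sup>2" by (simp only: Re_complex_of_real)
      also have "\<dots> = \<bar>c + G\<bar> + 1" using pos by (simp add: t_def)
      finally show False using est[of "of_real t * cnj A"] by linarith
    qed
    then show ?thesis by (simp add: A_def)
  qed
  have Jne: "J \<noteq> {}" using K by auto
  \<comment> \<open>The distance to \<open>J\<close> turns an arbitrary continuous test function
    into one that vanishes on \<open>J\<close>; it is positive off the closed set \<open>J\<close>,
    where alone \<open>\<psi>\<close> may be nonzero.\<close>
  have "AE z in circle_measure. complex_of_real (infdist z J) * cnj (\<psi> z) = 0"
  proof (rule AE_zero_if_integral_continuous)
    show "integrable circle_measure (\<lambda>z. complex_of_real (infdist z J) * cnj (\<psi> z))"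
      by (intro integrable_circle_mult i\<psi> continuous_intros)
    fix \<phi> :: "complex \<Rightarrow> real" assume \<phi>: "continuous_on UNIV \<phi>"
    have "(LINT z|circle_measure. of_real (\<phi> z * infdist z J) * cnj (\<psi> z)) = 0"
      by (rule orth) (auto intro!: continuous_intros \<phi>)
    then show "(LINT z|circle_measure. of_real (\<phi> z) * (complex_of_real (infdist z J) * cnj (\<psi> z))) = 0"
      by (simp add: mult.assoc)
  qed
  then show ?thesis
  proof eventually_elim
    case (elim z)
    then show ?case
      using \<psi>(2)[of z] in_closed_iff_infdist_zero[OF J Jne, of z] by auto
  qed
qed

text \<open>Perturbing \<open>g0\<close> along \<open>v - g0\<close> keeps the constraint as long as \<open>v\<close> is bounded by \<open>1\<close> off the
  set \<open>K\<close> where the constraint is slack; on \<open>K\<close> itself \<open>v\<close> may have any bound.\<close>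

lemma variational_inequality:
  assumes I: "I \<in> sets circle_measure"
    and f: "square_integrable circle_measure (\<lambda>z. of_bool (z \<in> I) * f z)"
    and g0: "g0 \<in> Hardy2" "bounded_by_1_on J g0"
    and min: "\<And>g. g \<in> Hardy2 \<Longrightarrow> bounded_by_1_on J g \<Longrightarrow>
      (LINT z|circle_measure. (cmod (of_bool (z \<in> I) * (f z - g0 z)))\<^sup>2) \<le>
      (LINT z|circle_measure. (cmod (of_bool (z \<in> I) * (f z - g z)))\<^sup>2)"
    and \<delta>: "0 < \<delta>" "\<delta> \<le> 1" and slack: "\<And>z. z \<in> K \<Longrightarrow> cmod (g0 z) \<le> 1 - \<delta>"
    and v: "v \<in> Hardy2" "AE z in circle_measure. cmod (v z) \<le> B"
      "AE z in circle_measure. z \<in> J - K \<longrightarrow> cmod (v z) \<le> 1"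
  shows "Re (LINT z|circle_measure. cnj (of_bool (z \<in> I) * (f z - g0 z)) * v z) \<le>
    Re (LINT z|circle_measure. cnj (of_bool (z \<in> I) * (f z - g0 z)) * g0 z)"
proof -
  define \<psi> where "\<psi> z = of_bool (z \<in> I) * (f z - g0 z)" for z
  define w where "w z = of_bool (z \<in> I) * (v z - g0 z)" for z
  have sq0: "square_integrable circle_measure g0" and sqv: "square_integrable circle_measure v"
    using g0(1) v(1) by (auto simp: Hardy2_iff)
  have sq\<psi>: "square_integrable circle_measure \<psi>"
    using square_integrable_diff[OF f square_integrable_of_bool_mult[OF sq0 I]]
    by (simp add: \<psi>_def[abs_def] right_diff_distrib)
  have sqw: "square_integrable circle_measure w"
    unfolding w_def[abs_def] by (intro square_integrable_of_bool_mult square_integrable_diff sqv sq0 I)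
  define X where "X = Re (LINT z|circle_measure. cnj (\<psi> z) * w z)"
  define Y where "Y = (LINT z|circle_measure. (cmod (w z))\<^sup>2)"
  define P where "P = (LINT z|circle_measure. (cmod (\<psi> z))\<^sup>2)"
  have Y: "0 \<le> Y" by (simp add: Y_def)
  have ic: "integrable circle_measure (\<lambda>z. cnj (\<psi> z) * w z)"
    by (rule integrable_mult_square_integrable[OF square_integrable_cnj[OF sq\<psi>] sqw])
  define B' where "B' = max B 0"
  \<comment> \<open>On \<open>J - K\<close> the competitor is a convex combination of numbers of
    modulus at most 1; on \<open>K\<close> the last condition on \<open>l\<close> keeps the
    contribution of \<open>v\<close> within the slack. Comparing squared distances gives
    \<open>2 * l * X <= l ^ 2 * Y\<close>, which is divided by \<open>l\<close>.\<close>
  have key: "2 * X \<le> l * Y" if l: "0 < l" "l \<le> 1" "l * (B' + 1) \<le> \<delta>" for l :: real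
  proof -
    define g where "g z = of_real (1 - l) * g0 z + of_real l * v z" for z
    have "AE z in circle_measure. z \<in> J \<longrightarrow> cmod (g z) \<le> 1"
      using g0(2)[unfolded bounded_by_1_on_def] v(2,3)
    proof eventually_elim
      case (elim z)
      show ?case
      proof
        assume z: "z \<in> J"
        have tri: "cmod (g z) \<le> (1 - l) * cmod (g0 z) + l * cmod (v z)"
          unfolding g_def using norm_triangle_ineq[of "of_real (1 - l) * g0 z" "of_real l * v z"] l
          by (simp add: norm_mult del: of_real_diff)
        show "cmod (g z) \<le> 1"
        proof (cases "z \<in> K")
          case True
          have "(1 - l) * cmod (g0 z) \<le> 1 * (1 - \<delta>)"
            using slack[OF True] l \<delta> by (intro mult_mono) auto
          moreover have "l * cmod (v z) \<le> l * (B' + 1)"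
            using elim l by (intro mult_left_mono) (auto simp: B'_def)
          ultimately have "cmod (g z) \<le> 1 * (1 - \<delta>) + l * (B' + 1)"
            using order_trans[OF tri add_mono] by blast
          then show ?thesis using l(3) by simp
        next
          case False
          then have "cmod (g0 z) \<le> 1" "cmod (v z) \<le> 1" using elim z by auto
          then have "(1 - l) * cmod (g0 z) + l * cmod (v z) \<le> (1 - l) * 1 + l * 1"
            using l by (intro add_mono mult_left_mono) auto
          then show ?thesis using tri by simp
        qed
      qed
    qed
    then have b: "bounded_by_1_on J g" by (simp add: bounded_by_1_on_def)
    have H: "g \<in> Hardy2"
      unfolding g_def[abs_def] by (rule Hardy2_linear_combination[OF g0(1) v(1)])
    have "P \<le> (LINT z|circle_measure. (cmod (of_bool (z \<in> I) * (f z - g z)))\<^sup>2)"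
      using min[OF H b] by (simp add: P_def \<psi>_def)
    also have "\<dots> = (LINT z|circle_measure. (cmod (\<psi> z))\<^sup>2 - 2 * l * Re (cnj (\<psi> z) * w z) + l\<^sup>2 * (cmod (w z))\<^sup>2)"
    proof (rule Bochner_Integration.integral_cong[OF refl])
      fix z
      have "of_bool (z \<in> I) * (f z - g z) = \<psi> z - of_real l * w z"
        by (simp add: \<psi>_def w_def g_def of_bool_def algebra_simps)
      moreover have "(cmod (a - of_real l * b))\<^sup>2 = (cmod a)\<^sup>2 - 2 * l * Re (cnj a * b) + l\<^sup>2 * (cmod b)\<^sup>2" for a b
        unfolding cmod_power2 by (simp add: power2_eq_square algebra_simps)
      ultimately show "(cmod (of_bool (z \<in> I) * (f z - g z)))\<^sup>2 =
          (cmod (\<psi> z))\<^sup>2 - 2 * l * Re (cnj (\<psi> z) * w z) + l\<^sup>2 * (cmod (w z))\<^sup>2" by (simp only:)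
    qed
    also have "\<dots> = P - 2 * l * X + l\<^sup>2 * Y"
    proof -
      define R where "R z = Re (cnj (\<psi> z) * w z)" for z
      have R: "integrable circle_measure R" "(LINT z|circle_measure. R z) = X"
        unfolding R_def X_def by (intro integrable_Re integral_Re ic)+
      show ?thesis
        using R square_integrable_norm_sq[OF sq\<psi>] square_integrable_norm_sq[OF sqw]
        unfolding R_def[symmetric] by (simp add: P_def Y_def)
    qed
    finally have "l * (2 * X) \<le> l * (l * Y)" by (simp add: power2_eq_square algebra_simps)
    then show ?thesis using l by simp
  qed
  have "X \<le> 0"
  proof (rule ccontr)
    assume "\<not> X \<le> 0"
    then have X: "0 < X" by simp
    have B': "0 \<le> B'" by (simp add: B'_def)
    \<comment> \<open>The first two bounds make the competitor admissible; the third gives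
      \<open>l * Y <= X\<close>, which contradicts \<open>2 * X <= l * Y\<close>.\<close>
    define l where "l = min (min 1 (\<delta> / (B' + 1))) (X / (Y + 1))"
    have l: "0 < l" "l \<le> 1" using \<delta> B' X Y by (simp_all add: l_def min_le_iff_disj)
    have "l \<le> \<delta> / (B' + 1)" by (simp add: l_def)
    then have "l * (B' + 1) \<le> \<delta>" using B' by (simp add: pos_le_divide_eq)
    from key[OF l this] have "2 * X \<le> l * Y" .
    also have "\<dots> \<le> X / (Y + 1) * Y" using Y by (intro mult_right_mono) (auto simp: l_def)
    also have "\<dots> \<le> X" using X Y by (simp add: field_simps)
    finally show False using X by simp
  qed
  moreover have "(LINT z|circle_measure. cnj (\<psi> z) * w z) =
      (LINT z|circle_measure. cnj (\<psi> z) * v z) - (LINT z|circle_measure. cnj (\<psi> z) * g0 z)"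
  proof -
    have "(LINT z|circle_measure. cnj (\<psi> z) * w z) =
        (LINT z|circle_measure. cnj (\<psi> z) * v z - cnj (\<psi> z) * g0 z)"
      by (rule Bochner_Integration.integral_cong) (auto simp: \<psi>_def w_def algebra_simps)
    then show ?thesis
      by (simp add: integrable_mult_square_integrable[OF square_integrable_cnj[OF sq\<psi>]] sqv sq0)
  qed
  ultimately show ?thesis by (simp add: X_def \<psi>_def)
qed

text \<open>If \<open>g0\<close> is not unimodular on \<open>J\<close>, some set \<open>K\<close> of
  positive measure in \<open>J\<close> carries a definite slack. The variational inequality then
  bounds the pairing of the residual with all admissible \<open>v\<close> by one constant, and the
  scaling argument makes the residual vanish.\<close>

lemma extremal_unimodular_or_interpolating:
  assumes I: "I \<in> sets circle_measure" and J: "closed J" "J \<in> sets circle_measure" and disj: "I \<inter> J = {}"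
    and f: "square_integrable circle_measure (\<lambda>z. of_bool (z \<in> I) * f z)"
    and g0: "g0 \<in> Hardy2" "bounded_by_1_on J g0"
    and min: "\<And>g. g \<in> Hardy2 \<Longrightarrow> bounded_by_1_on J g \<Longrightarrow>
      (LINT z|circle_measure. (cmod (of_bool (z \<in> I) * (f z - g0 z)))\<^sup>2) \<le>
      (LINT z|circle_measure. (cmod (of_bool (z \<in> I) * (f z - g z)))\<^sup>2)"
  shows "(AE z in circle_measure. z \<in> J \<longrightarrow> cmod (g0 z) = 1) \<or>
    (AE z in circle_measure. z \<in> I \<longrightarrow> f z = g0 z)"
proof (cases "\<forall>n. AE z in circle_measure. z \<in> J \<longrightarrow> 1 - 1 / real (Suc n) < cmod (g0 z)")
  \<comment> \<open>Countably many lower bounds tending to 1 hold simultaneously almost everywhere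
    and combine with the constraint to give modulus exactly 1.\<close>
  case True
  have "AE z in circle_measure. \<forall>n. z \<in> J \<longrightarrow> 1 - 1 / real (Suc n) < cmod (g0 z)"
    unfolding AE_all_countable using True by blast
  then have "AE z in circle_measure. z \<in> J \<longrightarrow> cmod (g0 z) = 1"
    using g0(2)[unfolded bounded_by_1_on_def]
  proof eventually_elim
    case (elim z)
    show ?case
    proof
      assume z: "z \<in> J"
      have "(\<lambda>n. 1 - 1 / real (Suc n)) \<longlonglongrightarrow> 1 - 0"
        by (intro tendsto_intros LIMSEQ_Suc[OF lim_1_over_n])
      then have "1 - 0 \<le> cmod (g0 z)"
        by (rule LIMSEQ_le_const2) (use elim z in \<open>auto intro: less_imp_le\<close>)
      then show "cmod (g0 z) = 1" using elim z by simp
    qed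
  qed
  then show ?thesis ..
next
  case False
  then obtain n where n: "\<not> (AE z in circle_measure. z \<in> J \<longrightarrow> 1 - 1 / real (Suc n) < cmod (g0 z))"
    by blast
  define \<delta> where "\<delta> = 1 / real (Suc n)"
  define K where "K = {z \<in> space circle_measure. z \<in> J \<and> cmod (g0 z) \<le> 1 - \<delta>}"
  have \<delta>: "0 < \<delta>" "\<delta> \<le> 1" by (auto simp: \<delta>_def)
  have sq0: "square_integrable circle_measure g0" using g0(1) by (simp add: Hardy2_iff)
  note [measurable] = square_integrable_measurable[OF sq0] J(2)
  have K: "K \<in> sets circle_measure"
    unfolding K_def using pred_sets2 by measurable
  have Kpos: "measure circle_measure K > 0"
  proof (rule ccontr)
    assume "\<not> measure circle_measure K > 0"
    then have "measure circle_measure K = 0" by (simp add: not_less measure_le_0_iff)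
    then have "emeasure circle_measure K = 0" by (simp add: circle.emeasure_eq_measure)
    then have "AE z in circle_measure. z \<notin> K"
      using K by (intro AE_not_in) (simp add: null_sets_def)
    then have "AE z in circle_measure. z \<in> J \<longrightarrow> 1 - 1 / real (Suc n) < cmod (g0 z)"
      using AE_space by eventually_elim (auto simp: K_def \<delta>_def)
    then show False using n by simp
  qed
  define \<psi> where "\<psi> z = of_bool (z \<in> I) * (f z - g0 z)" for z
  have "AE z in circle_measure. \<psi> z = 0"
  proof (rule orthogonal_to_admissible_imp_zero[OF J(1) K Kpos])
    show "K \<subseteq> J" by (auto simp: K_def)
    show "square_integrable circle_measure \<psi>"
      using square_integrable_diff[OF f square_integrable_of_bool_mult[OF sq0 I]]
      by (simp add: \<psi>_def[abs_def] right_diff_distrib)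
    show "\<psi> z = 0" if "z \<in> J" for z using that disj by (auto simp: \<psi>_def)
    show "Re (LINT z|circle_measure. cnj (\<psi> z) * v z) \<le>
        Re (LINT z|circle_measure. cnj (of_bool (z \<in> I) * (f z - g0 z)) * g0 z)"
      if "analytic_L2 v" "AE z in circle_measure. cmod (v z) \<le> B"
        "AE z in circle_measure. z \<in> J - K \<longrightarrow> cmod (v z) \<le> 1" for v B
      unfolding \<psi>_def
    proof (rule variational_inequality[OF I f g0 _ \<delta> _ analytic_L2_in_Hardy2[OF that(1)] that(2,3)])
      show "cmod (g0 z) \<le> 1 - \<delta>" if "z \<in> K" for z using that by (simp add: K_def)
    qed (rule min)
  qed
  then have "AE z in circle_measure. z \<in> I \<longrightarrow> f z = g0 z"
    by eventually_elim (auto simp: \<psi>_def)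
  then show ?thesis ..
qed

section \<open>The two problems as minimisation, and the theorem\<close>

lemma L2_norm_on_eq:
  "L2_norm_on I g = sqrt (LINT z|circle_measure. (cmod (of_bool (z \<in> I) * g z))\<^sup>2)"
  unfolding L2_norm_on_def set_lebesgue_integral_def
  by (intro arg_cong[where f = sqrt] Bochner_Integration.integral_cong) (auto simp: indicator_def)

text \<open>Translates the equations with \<open>INF\<close> in the two problems into minimality;
  nonnegativity supplies the lower bound without which a real infimum is uninformative.\<close>

lemma INF_attained_iff:
  fixes F :: "'a \<Rightarrow> real"
  assumes "x \<in> A" "\<And>y. y \<in> A \<Longrightarrow> 0 \<le> F y"
  shows "F x = (INF y\<in>A. F y) \<longleftrightarrow> (\<forall>y\<in>A. F x \<le> F y)"
proof
  assume "F x = (INF y\<in>A. F y)"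
  then show "\<forall>y\<in>A. F x \<le> F y"
    using assms(2) by (auto intro!: cINF_lower bdd_belowI2[where m = 0])
next
  assume "\<forall>y\<in>A. F x \<le> F y"
  then show "F x = (INF y\<in>A. F y)"
    using assms by (intro antisym cINF_greatest cINF_lower bdd_belowI2[where m = 0]) auto
qed

theorem theorem1:
  fixes I J :: "complex set" and f :: "complex \<Rightarrow> complex" and n :: nat
  assumes I: "\<exists>\<A>. finite \<A> \<and> \<A> \<noteq> {} \<and> (\<forall>A\<in>\<A>. open_arc A) \<and> I = \<Union>\<A>"
    and J: "J = unit_circle - I"
    and J_interior: "(top_of_set unit_circle) interior_of J \<noteq> {}"
    and f: "f \<in> L2_on I"
  shows "(\<exists>!k. PBEP_solution I J f n k)
    \<and> (\<exists>g0. ABEP_solution I J f g0 \<and>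
          (\<forall>g. ABEP_solution I J f g \<longrightarrow> (AE z in circle_measure. g z = g0 z)))
    \<and> (\<forall>g0. ABEP_solution I J f g0 \<longrightarrow>
          \<not> (\<exists>g\<in>Hardy2. Linf_norm_on J g \<le> 1 \<and>
                (AE z in circle_measure. z \<in> I \<longrightarrow> f z = g z)) \<longrightarrow>
          (AE z in circle_measure. z \<in> J \<longrightarrow> cmod (g0 z) = 1))"
proof -
  obtain \<A> where \<A>: "finite \<A>" "\<A> \<noteq> {}" "\<forall>A\<in>\<A>. open_arc A" "I = \<Union>\<A>" using I by blast
  then obtain A where A: "A \<in> \<A>" by blast
  have Im: "I \<in> sets circle_measure"
    unfolding \<A>(4) using \<A> open_arc_measurable by (intro sets.finite_Union) auto
  have Icirc: "I \<subseteq> unit_circle" using \<A> open_arc_subset_circle by blast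
  have Ipos: "0 < measure circle_measure I"
    using measure_open_arc_pos[of A] circle.finite_measure_mono[of A I] \<A> A Im by fastforce
  \<comment> \<open>Closedness of \<open>J\<close> is required for the argument with the distance to
    \<open>J\<close>. The family is nonempty, so the intersection stays within the circle.\<close>
  have "J = (\<Inter>A\<in>\<A>. unit_circle - A)" unfolding J \<A>(4) using A by auto
  moreover have "closed (\<Inter>A\<in>\<A>. unit_circle - A)"
    using \<A>(3) circle_diff_open_arc_compact compact_imp_closed by (intro closed_INT) blast
  ultimately have Jc: "closed J" by simp
  have Jm: "J \<in> sets circle_measure"
    unfolding J using Im sets.compl_sets by fastforce
  have cover: "I \<union> J = space circle_measure" using Icirc J by auto
  have disj: "I \<inter> J = {}" using J by blast
  have sqf: "square_integrable circle_measure (\<lambda>z. of_bool (z \<in> I) * f z)"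
  proof -
    have "(\<lambda>z. indicator I z *\<^sub>R f z) = (\<lambda>z. of_bool (z \<in> I) * f z)"
      "(\<lambda>z. indicator I z *\<^sub>R (cmod (f z))\<^sup>2) = (\<lambda>z. (cmod (of_bool (z \<in> I) * f z))\<^sup>2)"
      by (auto simp: indicator_def)
    then show ?thesis
      using f by (simp add: L2_on_def set_borel_measurable_def set_integrable_def square_integrable_def)
  qed
  define F where "F g = (LINT z|circle_measure. (cmod (of_bool (z \<in> I) * (f z - g z)))\<^sup>2)" for g
  have norm_F: "L2_norm_on I (\<lambda>z. f z - g z) = sqrt (F g)" for g
    by (simp add: L2_norm_on_eq F_def)
  define H where "H = {g \<in> Hardy2. bounded_by_1_on J g}"
  define P where "P = {p. degree p \<le> n \<and> bounded_by_1_on J (poly p)}"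
  have zeroP: "0 \<in> P" by (simp add: P_def bounded_by_1_on_def)
  have zeroH: "poly 0 \<in> H"
    using poly_in_Hardy2[of 0] by (simp add: H_def bounded_by_1_on_def)
  have mid: "bounded_by_1_on J (\<lambda>z. (g z + h z) / 2)" if "bounded_by_1_on J g" "bounded_by_1_on J h" for g h
    using that unfolding bounded_by_1_on_def
  proof eventually_elim
    case (elim z)
    then show ?case using norm_triangle_ineq[of "g z" "h z"] by (auto simp: norm_divide)
  qed
  interpret HA: restricted_approximation circle_measure I J f H
  proof unfold_locales
    show "(\<lambda>z. (g z + h z) / 2) \<in> H" if "g \<in> H" "h \<in> H" for g h
      using that mid Hardy2_linear_combination[of g h "1 / 2" "1 / 2"]
      by (simp add: H_def add_divide_distrib)
    show "\<exists>g'\<in>H. AE z in circle_measure. g' z = g z"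
      if lim: "L2_tendsto circle_measure s g" and s: "\<And>n. s n \<in> H" for s g
    proof
      show "g \<in> H"
        using Hardy2_closed[OF lim] L2_tendsto_AE_bounded[OF lim, of J 1] s
        by (simp add: H_def bounded_by_1_on_def)
    qed simp
  qed (use Im Jm cover sqf zeroH in \<open>auto simp: H_def Hardy2_iff bounded_by_1_on_def\<close>)
  interpret PA: restricted_approximation circle_measure I J f "poly ` P"
  proof unfold_locales
    show "poly ` P \<noteq> {}" using zeroP by blast
    show "square_integrable circle_measure g" if "g \<in> poly ` P" for g
      using that square_integrable_poly by blast
    show "(\<lambda>z. (g z + h z) / 2) \<in> poly ` P" if gh: "g \<in> poly ` P" "h \<in> poly ` P" for g h
    proof -
      obtain p q where pq: "p \<in> P" "q \<in> P" "g = poly p" "h = poly q" using gh by blast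
      have e: "poly (smult (1 / 2) (p + q)) = (\<lambda>z. (poly p z + poly q z) / 2)"
        by (simp add: fun_eq_iff)
      have "smult (1 / 2) (p + q) \<in> P"
        unfolding P_def using pq mid[of "poly p" "poly q"]
        by (auto simp: e P_def simp del: poly_smult poly_add intro: degree_add_le)
      then show ?thesis using pq e by (metis imageI)
    qed
    show "\<exists>g'\<in>poly ` P. AE z in circle_measure. g' z = g z"
      if lim: "L2_tendsto circle_measure s g" and s: "\<And>m. s m \<in> poly ` P" for s g
    proof -
      have "\<exists>k. \<forall>m. k m \<in> P \<and> s m = poly (k m)" using s by (intro choice) blast
      then obtain k where k: "\<And>m. k m \<in> P" "s = (\<lambda>m. poly (k m))" by auto
      obtain p where p: "degree p \<le> n" "AE z in circle_measure. poly p z = g z"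
        by (rule L2_tendsto_poly_degree_le[of k g n]) (use lim k in \<open>auto simp: P_def\<close>)
      have "AE z in circle_measure. z \<in> J \<longrightarrow> cmod (g z) \<le> 1"
        by (rule L2_tendsto_AE_bounded[OF lim]) (use k in \<open>simp add: P_def bounded_by_1_on_def\<close>)
      with p(2) have "bounded_by_1_on J (poly p)"
        unfolding bounded_by_1_on_def by eventually_elim simp
      then show ?thesis using p by (auto simp: P_def)
    qed
  qed (use Im Jm cover sqf zeroP in \<open>auto simp: P_def bounded_by_1_on_def\<close>)
  have F_HA: "HA.dist_sq g = F g" and F_PA: "PA.dist_sq g = F g" for g
    by (simp_all add: HA.dist_sq_def PA.dist_sq_def F_def)
  have P_iff: "PBEP_solution I J f n k \<longleftrightarrow> k \<in> P \<and> (\<forall>p\<in>P. F (poly k) \<le> F (poly p))" for k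
  proof (cases "k \<in> P")
    case True
    then show ?thesis
      using INF_attained_iff[of k P "\<lambda>p. sqrt (F (poly p))"]
      by (simp add: PBEP_solution_def norm_F F_def flip: P_def) (simp add: P_def)
  qed (auto simp: PBEP_solution_def P_def)
  have H_iff: "ABEP_solution I J f g \<longleftrightarrow> g \<in> H \<and> (\<forall>h\<in>H. F g \<le> F h)" for g
  proof (cases "g \<in> H")
    case True
    then show ?thesis
      using INF_attained_iff[of g H "\<lambda>h. sqrt (F h)"]
      by (simp add: ABEP_solution_def norm_F F_def flip: H_def) (simp add: H_def)
  qed (auto simp: ABEP_solution_def H_def)
  have "\<exists>!k. PBEP_solution I J f n k"
  proof (rule ex_ex1I)
    show "\<exists>k. PBEP_solution I J f n k"
      using PA.best_approximation_exists by (auto simp: P_iff F_PA)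
  next
    fix k q assume "PBEP_solution I J f n k" "PBEP_solution I J f n q"
    then have kq: "AE z in circle_measure. z \<in> I \<longrightarrow> poly k z = poly q z"
      by (intro PA.best_approximation_unique) (auto simp: P_iff F_PA)
    \<comment> \<open>Polynomials belong to \<open>Hardy2\<close>, so agreement on \<open>I\<close>,
      a set of positive measure, propagates to the whole circle as in the analytic problem.\<close>
    have "AE z in circle_measure. poly (k - q) z = 0"
      by (rule Hardy2_unique[OF poly_in_Hardy2 Im Ipos]) (use kq in \<open>auto elim: eventually_mono\<close>)
    then have "k - q = 0" by (rule poly_eq_0_if_AE)
    then show "k = q" by simp
  qed
  moreover have "\<exists>g0. ABEP_solution I J f g0 \<and>
          (\<forall>g. ABEP_solution I J f g \<longrightarrow> (AE z in circle_measure. g z = g0 z))"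
  proof -
    obtain g0 where g0: "g0 \<in> H" "\<forall>h\<in>H. F g0 \<le> F h"
      using HA.best_approximation_exists by (auto simp: F_HA)
    have "AE z in circle_measure. g z = g0 z" if "ABEP_solution I J f g" for g
    proof -
      have g: "g \<in> H" "\<forall>h\<in>H. F g \<le> F h" using that by (auto simp: H_iff)
      have eq: "AE z in circle_measure. z \<in> I \<longrightarrow> g z = g0 z"
        by (rule HA.best_approximation_unique) (use g g0 in \<open>auto simp: F_HA\<close>)
      have "(\<lambda>z. 1 * g z + (-1) * g0 z) \<in> Hardy2"
        using g g0 by (intro Hardy2_linear_combination) (auto simp: H_def)
      then have "AE z in circle_measure. 1 * g z + (-1) * g0 z = 0"
        by (rule Hardy2_unique[OF _ Im Ipos]) (use eq in \<open>auto elim: eventually_mono\<close>)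
      then show ?thesis by eventually_elim simp
    qed
    then show ?thesis using g0 by (auto simp: H_iff)
  qed
  moreover have "AE z in circle_measure. z \<in> J \<longrightarrow> cmod (g0 z) = 1"
    if sol: "ABEP_solution I J f g0"
      and no: "\<not> (\<exists>g\<in>Hardy2. Linf_norm_on J g \<le> 1 \<and>
                (AE z in circle_measure. z \<in> I \<longrightarrow> f z = g z))" for g0
  proof -
    have g0: "g0 \<in> Hardy2" "bounded_by_1_on J g0" and min: "\<And>h. h \<in> H \<Longrightarrow> F g0 \<le> F h"
      using sol by (auto simp: H_iff H_def)
    have [measurable]: "g0 \<in> borel_measurable circle_measure"
      using g0(1) by (simp add: Hardy2_iff square_integrable_measurable)
    \<comment> \<open>If \<open>f\<close> agreed with \<open>g0\<close> on \<open>I\<close>, then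
      \<open>g0\<close> itself would be the excluded interpolant, provided that its constraint is
      expressed through the essential supremum on \<open>J\<close>.\<close>
    have "(\<lambda>z. ereal (cmod (g0 z))) \<in> borel_measurable circle_measure"
      by measurable
    then have "(\<lambda>z. ereal (cmod (g0 z))) \<in> borel_measurable (restrict_space circle_measure J)"
      by (rule measurable_restrict_space1)
    moreover have "AE z in restrict_space circle_measure J. ereal (cmod (g0 z)) \<le> 1"
      using g0(2) Jm sets.Int_space_eq2[OF Jm]
      by (subst AE_restrict_space_iff) (auto simp: bounded_by_1_on_def)
    ultimately have "Linf_norm_on J g0 \<le> 1"
      unfolding Linf_norm_on_def by (rule esssup_I)
    then have "\<not> (AE z in circle_measure. z \<in> I \<longrightarrow> f z = g0 z)"
      using no g0(1) by blast
    moreover have "(AE z in circle_measure. z \<in> J \<longrightarrow> cmod (g0 z) = 1) \<or>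
        (AE z in circle_measure. z \<in> I \<longrightarrow> f z = g0 z)"
      by (rule extremal_unimodular_or_interpolating[OF Im Jc Jm disj sqf g0])
        (use min in \<open>auto simp: H_def F_def\<close>)
    ultimately show ?thesis by blast
  qed
  ultimately show ?thesis by blast
qed

end
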